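(* For every $\epsilon>0$ there exists $M(\epsilon)$ (depending only on $\epsilon$) such that for every integer $m>M(\epsilon)$ the following holds. Let $R>0$ and let $\mathbb{S}^{m-1}=\{\mathbf z\in\mathbb{R}^m:\|\mathbf z\|=R\}$. Let $A\subseteq\mathbb{S}^{m-1}$ be any measurable set with effective angle $\theta\in(0,\pi]$, let $\omega\in[0,\pi]$ satisfy $\theta+\omega>\pi/2$, and let $$V=\mu\big(\mathrm{Cap}(\mathbf z_0,\theta)\cap\mathrm{Cap}(\mathbf y_0,\omega)\big),$$ where $\mathbf z_0,\mathbf y_0\in\mathbb{S}^{m-1}$ are points with $\angle(\mathbf z_0,\mathbf y_0)=\pi/2$. Then $$\mathbb{P}\Big(\mu\big(A\cap\mathrm{Cap}(\mathbf Y,\omega+\epsilon)\big)>(1-\epsilon)V\Big)\ge 1-\epsilon,$$ where $\mathbf Y$ is a random vector on $\mathbb{S}^{m-1}$ distributed according to the normalized Haar (rotation-invariant) probability measure $\mathbb{P}$.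
   Context: $\mathbb{S}^{m-1}\subseteq\mathbb{R}^m$ is the $(m-1)$-sphere of radius $R$ centered at the origin. $\mu$ is the rotation-invariant (Haar) measure on $\mathbb{S}^{m-1}$ normalized to be the usual surface area, i.e. $\mu(\mathbb{S}^{m-1})=\frac{2\pi^{m/2}}{\Gamma(m/2)}R^{m-1}$. $\mathbb{P}$ denotes the corresponding rotation-invariant probability measure, normalized so that $\mathbb{P}(\mathbb{S}^{m-1})=1$. The geodesic (angular) metric is $\angle(\mathbf z,\mathbf y)=\arccos(\langle\mathbf z/R,\mathbf y/R\rangle)\in[0,\pi]$. The spherical cap with pole $\mathbf z_0\in\mathbb{S}^{m-1}$ and angle $\theta$ is $$\mathrm{Cap}(\mathbf z_0,\theta)=\{\mathbf z\in\mathbb{S}^{m-1}:\angle(\mathbf z_0,\mathbf z)\le\theta\}$$ (so it is the whole sphere if $\theta\ge\pi$). A measurable set $A\subseteq\mathbb{S}^{m-1}$ has effective angle $\theta$ if $\mu(A)=\mu(\mathrm{Cap}(\mathbf z_0,\theta))$ for some (equivalently, by rotation invariance, every) $\mathbf z_0\in\mathbb{S}^{m-1}$. By rotation invariance, $V$ does not depend on the choice of $\mathbf z_0,\mathbf y_0$ with $\angle(\mathbf z_0,\mathbf y_0)=\pi/2$. *)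

theory Defs
  imports "HOL-Probability.Probability"
begin

text \<open>
  The dimension \<open>m\<close> is quantified inside the theorem, so \<open>\<real>\<^sup>m\<close> is the space of extensional
  functions \<open>{..<m} \<rightarrow>\<^sub>E UNIV\<close>, with Borel \<open>\<sigma>\<close>-algebra \<open>Pi\<^sub>M {..<m} (\<lambda>_. borel)\<close> and
  Euclidean norm \<open>L2_set z {..<m}\<close>.
\<close>

definition euc_sphere :: "nat \<Rightarrow> real \<Rightarrow> (nat \<Rightarrow> real) set" where
  "euc_sphere m R = {z \<in> {..<m} \<rightarrow>\<^sub>E UNIV. L2_set z {..<m} = R}"

definition sph_angle :: "nat \<Rightarrow> real \<Rightarrow> (nat \<Rightarrow> real) \<Rightarrow> (nat \<Rightarrow> real) \<Rightarrow> real" where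
  "sph_angle m R z y = arccos (\<Sum>i<m. (z i / R) * (y i / R))"

definition sph_cap :: "nat \<Rightarrow> real \<Rightarrow> (nat \<Rightarrow> real) \<Rightarrow> real \<Rightarrow> (nat \<Rightarrow> real) set" where
  "sph_cap m R z\<^sub>0 \<theta> = {z \<in> euc_sphere m R. sph_angle m R z\<^sub>0 z \<le> \<theta>}"

definition orthogonal_mat :: "nat \<Rightarrow> (nat \<Rightarrow> nat \<Rightarrow> real) \<Rightarrow> bool" where
  "orthogonal_mat m Q \<longleftrightarrow>
     (\<forall>i<m. \<forall>j<m. (\<Sum>k<m. Q k i * Q k j) = (if i = j then 1 else 0))"

definition mat_apply :: "nat \<Rightarrow> (nat \<Rightarrow> nat \<Rightarrow> real) \<Rightarrow> (nat \<Rightarrow> real) \<Rightarrow> (nat \<Rightarrow> real)" where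
  "mat_apply m Q x = (\<lambda>i\<in>{..<m}. \<Sum>j<m. Q i j * x j)"

text \<open>
  \<open>\<mu>\<close> is the Borel measure on the sphere of radius \<open>R\<close> that is invariant under the orthogonal
  group and has total mass the surface area; these properties determine it uniquely.
\<close>

definition is_surface_measure :: "nat \<Rightarrow> real \<Rightarrow> (nat \<Rightarrow> real) measure \<Rightarrow> bool" where
  "is_surface_measure m R \<mu> \<longleftrightarrow>
     sets \<mu> = sets (restrict_space (Pi\<^sub>M {..<m} (\<lambda>_. borel)) (euc_sphere m R)) \<and>
     (\<forall>Q. orthogonal_mat m Q \<longrightarrow> distr \<mu> \<mu> (mat_apply m Q) = \<mu>) \<and>
     emeasure \<mu> (euc_sphere m R) =
       ennreal (2 * pi powr (real m / 2) / Gamma (real m / 2) * R ^ (m - 1))"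

definition normalized_measure :: "'a measure \<Rightarrow> 'a measure" where
  "normalized_measure \<mu> = uniform_measure \<mu> (space \<mu>)"

definition has_effective_angle ::
  "nat \<Rightarrow> real \<Rightarrow> (nat \<Rightarrow> real) measure \<Rightarrow> (nat \<Rightarrow> real) set \<Rightarrow> real \<Rightarrow> bool" where
  "has_effective_angle m R \<mu> A \<theta> \<longleftrightarrow>
     (\<exists>z\<^sub>0\<in>euc_sphere m R. measure \<mu> A = measure \<mu> (sph_cap m R z\<^sub>0 \<theta>))"

end

theory Submission
  imports Defs
begin

text \<open>
  Let \<open>P\<close> be the normalized measure, \<open>\<psi> y\<close> the measure of \<open>A \<inter> Cap(y, \<omega> + \<epsilon>)\<close>, and \<open>\<psi>*\<close> the same
  function for the cap \<open>A* = Cap(z\<^sub>0, \<theta>)\<close> in place of \<open>A\<close>. Riesz' rearrangement inequality on the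
  sphere bounds the integral of \<open>\<psi>\<close> over a set \<open>C\<close> by the integral of \<open>\<psi>*\<close> over the cap \<open>C*\<close>
  around \<open>z\<^sub>0\<close> with \<open>P C* = P C\<close>. The integrals over the whole sphere agree, so on the complement
  \<open>B\<close> of \<open>C\<close> the inequality is reversed. If \<open>B\<close> is the set where \<open>\<psi> \<le> (1 - \<epsilon>) V\<close>, the integral of
  \<open>\<psi>\<close> over \<open>B\<close> is at most \<open>(1 - \<epsilon>) V P(B)\<close>. On the other hand \<open>\<psi>* \<ge> V\<close> within angle \<open>\<epsilon>\<close> of the
  equator orthogonal to \<open>z\<^sub>0\<close>, whose complement has probability \<open>\<delta> \<le> 1 / (m sin\<^sup>2 \<epsilon>)\<close> by Chebyshev's
  inequality. Hence \<open>V (P(B) - \<delta>) \<le> (1 - \<epsilon>) V P(B)\<close>, and \<open>P(B) > \<epsilon>\<close> is impossible once \<open>\<delta> < \<epsilon>\<^sup>2\<close>.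

  Riesz' inequality is proved by polarization. Replacing two functions by their polarizations in a
  reflection increases the double integral against a kernel that is nondecreasing in the inner
  product. For functions that are uniformly continuous at a fixed scale, a reflection exchanging
  two points at which monotonicity towards \<open>z\<^sub>0\<close> fails by a definite amount also increases the
  first moment in direction \<open>z\<^sub>0\<close> by a definite amount; as this moment is bounded, finitely many
  polarizations make both functions almost monotone, and no compactness argument is needed.
\<close>

section \<open>Reflections of the sphere\<close>

text \<open>The analysis is done for a probability measure characterized by invariance alone; the
  surface area enters only when the final theorem is reduced to this setting. \<open>m_ge2\<close>
  provides a direction orthogonal to a given one.\<close>

locale sphere_prob = prob_space N for N :: "(nat \<Rightarrow> real) measure" +
  fixes m :: nat and R :: real
  assumes R_pos: "R > 0" and m_ge2: "m \<ge> 2"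
    and sets_N: "sets N = sets (restrict_space (Pi\<^sub>M {..<m} (\<lambda>_. borel)) (euc_sphere m R))"
    and invariant: "\<And>Q. orthogonal_mat m Q \<Longrightarrow> distr N N (mat_apply m Q) = N"
begin

abbreviation "S \<equiv> euc_sphere m R"

text \<open>Dividing by \<open>R\<close> turns points of the sphere into unit vectors, so
  \<open>ip\<close> is the cosine of the angle between them.\<close>

definition ip :: "(nat \<Rightarrow> real) \<Rightarrow> (nat \<Rightarrow> real) \<Rightarrow> real" where
  "ip x y = (\<Sum>i<m. (x i / R) * (y i / R))"

definition lincomb :: "real \<Rightarrow> (nat \<Rightarrow> real) \<Rightarrow> real \<Rightarrow> (nat \<Rightarrow> real) \<Rightarrow> nat \<Rightarrow> real" where
  "lincomb a x b y = (\<lambda>i\<in>{..<m}. a * x i + b * y i)"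

text \<open>The reflection in the hyperplane orthogonal to \<open>u\<close>, which need not be
  normalized. For \<open>ip u u = 0\<close> division by zero yields the coefficient 0, and every
  point of the sphere is fixed.\<close>

definition reflect :: "(nat \<Rightarrow> real) \<Rightarrow> (nat \<Rightarrow> real) \<Rightarrow> nat \<Rightarrow> real" where
  "reflect u x = lincomb 1 x (- 2 * ip u x / ip u u) u"

lemma ip_commute: "ip x y = ip y x"
  by (simp add: ip_def mult.commute)

lemma ip_lincomb_left: "ip (lincomb a x b y) z = a * ip x z + b * ip y z"
  by (simp add: ip_def lincomb_def sum_distrib_left sum.distrib[symmetric] add_divide_distrib
      algebra_simps)

lemma ip_lincomb_right: "ip z (lincomb a x b y) = a * ip z x + b * ip z y"
  using ip_lincomb_left ip_commute by metis

lemmas ip_lincomb = ip_lincomb_left ip_lincomb_right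

lemma ip_nonneg: "ip x x \<ge> 0"
  by (auto simp: ip_def intro!: sum_nonneg)

lemma Cauchy_Schwarz_ip: "(ip x y)\<^sup>2 \<le> ip x x * ip y y"
  using Cauchy_Schwarz_ineq_sum[of "\<lambda>i. x i / R" "\<lambda>i. y i / R" "{..<m}"]
  by (simp add: ip_def power2_eq_square)

lemma ip_eq_0: "ip u u = 0 \<Longrightarrow> ip u x = 0"
  using Cauchy_Schwarz_ip[of u x] by simp

lemma sphere_iff: "x \<in> S \<longleftrightarrow> x \<in> extensional {..<m} \<and> ip x x = 1"
proof -
  have "ip x x = (\<Sum>i<m. (x i)\<^sup>2) / R\<^sup>2"
    by (simp add: ip_def sum_divide_distrib power2_eq_square)
  moreover have "L2_set x {..<m} = R \<longleftrightarrow> (\<Sum>i<m. (x i)\<^sup>2) = R\<^sup>2"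
    using R_pos by (auto simp: L2_set_def real_sqrt_eq_iff sum_nonneg)
  ultimately show ?thesis
    using R_pos by (auto simp: euc_sphere_def PiE_def field_simps)
qed

lemma ip_sphere: "x \<in> S \<Longrightarrow> ip x x = 1"
  by (simp add: sphere_iff)

lemma abs_ip_le: "x \<in> S \<Longrightarrow> y \<in> S \<Longrightarrow> \<bar>ip x y\<bar> \<le> 1"
  using Cauchy_Schwarz_ip[of x y] by (simp add: ip_sphere abs_square_le_1)

lemma lincomb_in_sphere:
  "a\<^sup>2 * ip x x + 2 * a * b * ip x y + b\<^sup>2 * ip y y = 1 \<Longrightarrow> lincomb a x b y \<in> S"
  by (simp add: sphere_iff ip_lincomb, auto simp: lincomb_def ip_commute[of y x] power2_eq_square
      algebra_simps)

lemma ip_reflect: "ip x (reflect u y) = ip x y - 2 * ip u x * ip u y / ip u u"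
  by (simp add: reflect_def ip_lincomb ip_commute[of x u])

lemma ip_reflect_axis: "ip u (reflect u x) = - ip u x"
  using ip_eq_0[of u x] by (cases "ip u u = 0") (simp_all add: ip_reflect)

lemma ip_reflect_reflect: "ip (reflect u x) (reflect u y) = ip x y"
  by (simp add: ip_reflect ip_reflect_axis, simp add: ip_commute[of _ y] ip_reflect)

lemma ip_reflect_left: "ip (reflect u x) y = ip x (reflect u y)"
  by (simp add: ip_reflect ip_commute[of _ y])

lemma reflect_in_sphere: "x \<in> S \<Longrightarrow> reflect u x \<in> S"
  by (simp add: sphere_iff ip_reflect_reflect) (simp add: reflect_def lincomb_def)

lemma reflect_reflect: "x \<in> S \<Longrightarrow> reflect u (reflect u x) = x"
  unfolding reflect_def[of u "reflect u x"] ip_reflect_axis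
  by (rule extensionalityI[of _ "{..<m}"]) (auto simp: sphere_iff reflect_def lincomb_def)

text \<open>The axis \<open>u = x - y\<close> satisfies \<open>ip u u = 2 * ip u x\<close>, so the
  coefficient of the reflection is -1. If \<open>x = y\<close>, the axis vanishes and the reflection
  is the identity. Through this lemma reflections take the place of general rotations.\<close>

lemma reflect_swap:
  assumes "x \<in> S" "y \<in> S"
  shows "reflect (lincomb 1 x (- 1) y) x = y"
proof (cases "ip x y = 1")
  case True
  define u where "u = lincomb 1 x (- 1) y"
  have "ip u u = 0"
    using assms True by (simp add: u_def ip_lincomb ip_sphere ip_commute[of y x])
  then have "\<forall>i<m. u i = 0"
    using R_pos by (auto simp: ip_def sum_nonneg_eq_0_iff)
  then have "x i = y i" if "i < m" for i
    using that by (auto simp: u_def lincomb_def)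
  then show ?thesis
    using assms \<open>ip u u = 0\<close>
    by (intro extensionalityI[of _ "{..<m}"])
       (auto simp: sphere_iff reflect_def lincomb_def u_def)
next
  case False
  have "- 2 * ip (lincomb 1 x (- 1) y) x / ip (lincomb 1 x (- 1) y) (lincomb 1 x (- 1) y) = - 1"
    using assms False by (simp add: ip_lincomb ip_sphere ip_commute[of y x] field_simps)
  then show ?thesis
    using assms unfolding reflect_def
    by (intro extensionalityI[of _ "{..<m}"]) (auto simp: sphere_iff lincomb_def)
qed

text \<open>The last hypothesis bounds the squared norm of \<open>x - w\<close> by the square of
  \<open>e\<close>; the rest is Cauchy-Schwarz for \<open>z\<close> and
  \<open>x - w\<close>.\<close>

lemma ip_close:
  assumes "z \<in> S" "w \<in> S" "x \<in> S" "e \<ge> 0" "ip w x \<ge> 1 - e\<^sup>2 / 2"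
  shows "\<bar>ip z x - ip z w\<bar> \<le> e"
proof -
  have "(ip z (lincomb 1 x (- 1) w))\<^sup>2 \<le> 2 - 2 * ip w x"
    using Cauchy_Schwarz_ip[of z "lincomb 1 x (- 1) w"] assms
    by (simp add: ip_lincomb ip_sphere ip_commute[of x w])
  then have "(ip z x - ip z w)\<^sup>2 \<le> e\<^sup>2"
    using assms by (simp add: ip_lincomb field_simps)
  then show ?thesis
    using assms(4) abs_le_square_iff[of "ip z x - ip z w" e] by simp
qed

lemma space_N: "space N = S"
  using sets_eq_imp_space_eq[OF sets_N]
  by (auto simp: space_restrict_space space_PiM euc_sphere_def)

lemma measurable_component_N [measurable]: "i < m \<Longrightarrow> (\<lambda>x. x i) \<in> borel_measurable N"
  by (subst measurable_cong_sets[OF sets_N refl])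
     (auto intro!: measurable_restrict_space1 measurable_component_singleton)

lemma ip_measurable_pair: 
  assumes "f \<in> measurable M N" "g \<in> measurable M N"
  shows "(\<lambda>z. ip (f z) (g z)) \<in> borel_measurable M"
  unfolding ip_def using assms measurable_compose[OF _ measurable_component_N]
  by (intro borel_measurable_sum borel_measurable_times borel_measurable_divide) auto

lemma ip_measurable [measurable]: "(\<lambda>x. ip y x) \<in> borel_measurable N"
  unfolding ip_def by (intro borel_measurable_sum) simp

lemma ip_measurable' [measurable]: "(\<lambda>x. ip x y) \<in> borel_measurable N"
  unfolding ip_commute[of _ y] by simp

lemma reflect_measurable [measurable]: "reflect u \<in> measurable N N"
proof -
  have "reflect u \<in> measurable N (restrict_space (Pi\<^sub>M {..<m} (\<lambda>_. borel)) S)"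
    by (intro measurable_restrict_space2)
       (use reflect_in_sphere in \<open>auto simp: space_N\<close>, auto simp: reflect_def[abs_def] lincomb_def
           intro!: measurable_restrict)
  then show ?thesis
    by (subst measurable_cong_sets[OF _ sets_N]) auto
qed

text \<open>The matrix of the reflection is the identity minus \<open>c\<close> times the outer
  product of \<open>u\<close> with itself; the square of \<open>R\<close> in \<open>c\<close> undoes
  the scaling of \<open>ip\<close>. Degenerate axes give \<open>c = 0\<close> and the identity
  matrix.\<close>

lemma distr_reflect: "distr N N (reflect u) = N"
proof -
  define c where "c = 2 / (R\<^sup>2 * ip u u)"
  define Q where "Q = (\<lambda>i j. (if i = j then 1 else 0) - c * u i * u j)"
  have s: "(\<Sum>k<m. u k * u k) = R\<^sup>2 * ip u u"
    using R_pos by (simp add: ip_def sum_distrib_left power2_eq_square)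
  have "(\<Sum>k<m. Q k i * Q k j) = (if i = j then 1 else 0)" if "i < m" "j < m" for i j
  proof -
    \<comment> \<open>Written with Kronecker deltas, each term can be summed over \<open>k\<close>
      at once.\<close>
    have "Q k i * Q k j = (if k = i then (if i = j then 1 else 0) else 0) 
        - (if k = i then c * u i * u j else 0) - (if k = j then c * u i * u j else 0)
        + c\<^sup>2 * u i * u j * (u k * u k)" for k
      by (auto simp: Q_def power2_eq_square algebra_simps)
    then have "(\<Sum>k<m. Q k i * Q k j) = (if i = j then 1 else 0) - 2 * c * u i * u j
        + c\<^sup>2 * u i * u j * (R\<^sup>2 * ip u u)"
      using that by (simp add: sum.distrib sum_subtractf sum_distrib_left[symmetric] s)
    also have "c\<^sup>2 * (R\<^sup>2 * ip u u) = 2 * c"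
      using R_pos by (simp add: c_def power2_eq_square)
    then have "c\<^sup>2 * u i * u j * (R\<^sup>2 * ip u u) = 2 * c * u i * u j"
      by algebra
    finally show ?thesis by simp
  qed
  then have "orthogonal_mat m Q" by (simp add: orthogonal_mat_def)
  moreover have "mat_apply m Q x = reflect u x" for x
  proof -
    have "(\<Sum>j<m. Q i j * x j) = x i + - 2 * ip u x / ip u u * u i" if "i < m" for i
    proof -
      have "Q i j * x j = (if j = i then x j else 0) - c * u i * R\<^sup>2 * ((u j / R) * (x j / R))" for j
        using R_pos by (auto simp: Q_def power2_eq_square algebra_simps)
      then have "(\<Sum>j<m. Q i j * x j) = x i - c * u i * R\<^sup>2 * ip u x"
        using that by (simp add: sum_subtractf sum_distrib_left ip_def)
      then show ?thesis using R_pos by (simp add: c_def)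
    qed
    then show ?thesis by (auto simp: mat_apply_def reflect_def lincomb_def)
  qed
  then have "mat_apply m Q = reflect u" by (rule ext)
  ultimately show ?thesis using invariant[of Q] by simp
qed

lemma integral_reflect:
  fixes f :: "(nat \<Rightarrow> real) \<Rightarrow> real"
  assumes "f \<in> borel_measurable N"
  shows "(\<integral>x. f (reflect u x) \<partial>N) = (\<integral>x. f x \<partial>N)"
  using integral_distr[OF reflect_measurable assms, of u] by (simp add: distr_reflect)

lemma prob_reflect:
  assumes "A \<in> sets N"
  shows "prob {x \<in> S. reflect u x \<in> A} = prob A"
proof -
  have "prob A = measure (distr N N (reflect u)) A" by (simp add: distr_reflect)
  also have "\<dots> = prob {x \<in> S. reflect u x \<in> A}"
    using assms by (subst measure_distr)
        (auto simp: space_N vimage_def Int_def intro!: arg_cong[where f=prob])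
  finally show ?thesis by simp
qed

section \<open>Invariant probability of caps and levels\<close>

text \<open>The reflection exchanging the two poles preserves the measure and carries one set to the
  other.\<close>

lemma prob_ip_eq:
  assumes "z \<in> S" "w \<in> S" and B[measurable]: "B \<in> sets borel"
  shows "prob {x \<in> S. ip z x \<in> B} = prob {x \<in> S. ip w x \<in> B}"
proof -
  have A: "{x \<in> S. ip z x \<in> B} \<in> sets N"
    unfolding space_N[symmetric] by measurable
  have "ip z (reflect (lincomb 1 z (- 1) w) x) = ip w x" for x
    using reflect_swap[OF assms(1,2)] ip_reflect_left by metis
  then show ?thesis
    using prob_reflect[OF A, of "lincomb 1 z (- 1) w"]
      by (simp add: reflect_in_sphere conj_commute cong: conj_cong)
qed

lemma integral_ip_eq:
  fixes h :: "real \<Rightarrow> real"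
  assumes "z \<in> S" "w \<in> S" and [measurable]: "h \<in> borel_measurable borel"
  shows "(\<integral>x. h (ip z x) \<partial>N) = (\<integral>x. h (ip w x) \<partial>N)"
proof -
  have "ip z (reflect (lincomb 1 z (- 1) w) x) = ip w x" for x
    using reflect_swap[OF assms(1,2)] ip_reflect_left by metis
  then show ?thesis
    using integral_reflect[of "\<lambda>x. h (ip z x)" "lincomb 1 z (- 1) w"] by simp
qed

text \<open>Countably many caps of the given size cover the sphere, one for each nonempty cell of a
  cubic grid. If one cap were null, all would be null by invariance, and so would be the
  sphere.\<close>

lemma prob_cap_pos:
  assumes "w \<in> S" "c < 1"
  shows "prob {x \<in> S. c \<le> ip w x} > 0"
proof (rule ccontr)
  assume "\<not> ?thesis"
  then have w0: "prob {x \<in> S. c \<le> ip w x} = 0"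
    by (simp add: zero_less_measure_iff)
  have null: "prob {x \<in> S. c \<le> ip y x} = 0" if "y \<in> S" for y
    using prob_ip_eq[OF that assms(1), of "{c..}"] w0 by simp
  \<comment> \<open>Cells have side \<open>sqrt e\<close>: summed over \<open>m\<close> coordinates,
    two points of one cell have scaled squared distance at most \<open>1 - c\<close>.\<close>
  define e where "e = R\<^sup>2 * (1 - c) / m"
  have e: "e > 0" using assms R_pos m_ge2 by (simp add: e_def)
  define j where "j = (\<lambda>x. \<lambda>i\<in>{..<m}. \<lfloor>x i / sqrt e\<rfloor>)"
  have "countable (j ` S)"
    by (rule countable_subset[of _ "{..<m} \<rightarrow>\<^sub>E UNIV"])
        (auto simp: j_def intro!: countable_PiE split: if_splits)
  \<comment> \<open>A representative point for each cell, the pole of its cap.\<close>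
  define r where "r = inv_into S j"
  have cover: "S \<subseteq> (\<Union>k\<in>j ` S. {x \<in> S. c \<le> ip (r k) x})"
  proof
    fix x assume x: "x \<in> S"
    define y where "y = r (j x)"
    have y: "y \<in> S" "j y = j x"
      using x unfolding y_def r_def by (auto simp: inv_into_into f_inv_into_f)
    have "(x i / R - y i / R)\<^sup>2 \<le> e / R\<^sup>2" if "i < m" for i
    proof -
      have "\<lfloor>x i / sqrt e\<rfloor> = \<lfloor>y i / sqrt e\<rfloor>"
        using y(2) that by (auto simp: j_def fun_eq_iff restrict_def split: if_splits)
      then have "\<bar>x i / sqrt e - y i / sqrt e\<bar> \<le> 1" by linarith
      then have "\<bar>x i - y i\<bar> \<le> sqrt e"
        using e by (simp add: diff_divide_distrib[symmetric])
      then have "(x i - y i)\<^sup>2 \<le> e"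
        using e real_sqrt_le_iff[of "(x i - y i)\<^sup>2" e] by simp
      then show ?thesis
        by (simp add: diff_divide_distrib[symmetric] power_divide divide_right_mono)
    qed
    then have "(\<Sum>i<m. (x i / R - y i / R)\<^sup>2) \<le> (\<Sum>i<m. e / R\<^sup>2)"
      by (intro sum_mono) auto
    also have "\<dots> = 1 - c" using R_pos m_ge2 by (simp add: e_def)
    also have "(\<Sum>i<m. (x i / R - y i / R)\<^sup>2) = ip x x + ip y y - 2 * ip y x"
      unfolding ip_def sum_distrib_left sum.distrib[symmetric] sum_subtractf[symmetric]
      by (intro sum.cong refl) (simp add: power2_eq_square algebra_simps)
    finally have "c \<le> ip y x" using x y assms by (simp add: ip_sphere)
    then show "x \<in> (\<Union>k\<in>j ` S. {x \<in> S. c \<le> ip (r k) x})"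
      using x y by (auto simp: y_def)
  qed
  have "{x \<in> S. c \<le> ip (r k) x} \<in> null_sets N" if "k \<in> j ` S" for k
  proof -
    have "r k \<in> S" using that by (simp add: r_def inv_into_into)
    moreover have "{x \<in> S. c \<le> ip (r k) x} \<in> sets N"
      unfolding space_N[symmetric] by measurable
    ultimately show ?thesis
      using null by (simp add: null_sets_def emeasure_eq_measure)
  qed
  then have "(\<Union>k\<in>j ` S. {x \<in> S. c \<le> ip (r k) x}) \<in> null_sets N"
    by (rule null_sets_UN'[OF \<open>countable (j ` S)\<close>])
  then have "S \<in> null_sets N"
    using cover by (intro null_sets_subset[of _ N S]) (simp_all add: space_N[symmetric])
  then show False
    using prob_space by (simp add: null_sets_def space_N[symmetric] emeasure_eq_measure)
qed

text \<open>The coordinate vectors, stretched to length \<open>R\<close> so that they lie on the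
  sphere.\<close>

definition basis :: "nat \<Rightarrow> nat \<Rightarrow> real" where
  "basis i = (\<lambda>j\<in>{..<m}. if j = i then R else 0)"

lemma ip_basis: "i < m \<Longrightarrow> ip (basis i) x = x i / R"
  using R_pos by (simp add: ip_def basis_def if_distrib[of "\<lambda>a. a * _"] if_distrib[of "\<lambda>a. a / _"]
      cong: if_cong)

lemma basis_in_sphere: "i < m \<Longrightarrow> basis i \<in> S"
  using R_pos by (simp add: sphere_iff ip_basis) (simp add: basis_def)

text \<open>By invariance every coordinate direction has the same second moment as \<open>z\<close>,
  and the squares of the scaled coordinates add up to 1.\<close>

lemma integral_ip_sq:
  assumes "z \<in> S"
  shows "(\<integral>x. (ip z x)\<^sup>2 \<partial>N) = 1 / m"
proof -
  have bd: "integrable N (\<lambda>x. (ip (basis i) x)\<^sup>2)" if "i < m" for i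
    by (rule integrable_const_bound[of _ 1])
       (use abs_ip_le[OF basis_in_sphere[OF that]] in \<open>auto simp: space_N power_le_one_iff
           abs_square_le_1\<close>)
  have "real m * (\<integral>x. (ip z x)\<^sup>2 \<partial>N) = (\<Sum>i<m. \<integral>x. (ip z x)\<^sup>2 \<partial>N)" by simp
  also have "\<dots> = (\<Sum>i<m. \<integral>x. (ip (basis i) x)\<^sup>2 \<partial>N)"
    using integral_ip_eq[OF assms basis_in_sphere, of _ "\<lambda>t. t\<^sup>2"] by (intro sum.cong) auto
  also have "\<dots> = (\<integral>x. (\<Sum>i<m. (ip (basis i) x)\<^sup>2) \<partial>N)"
    using bd by (subst Bochner_Integration.integral_sum) auto
  also have "\<dots> = (\<integral>x. 1 \<partial>N)"
  proof (intro Bochner_Integration.integral_cong refl)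
    fix x assume "x \<in> space N"
    then have "(\<Sum>i<m. (x i / R)\<^sup>2) = 1"
      using ip_sphere[of x] by (simp add: space_N ip_def power2_eq_square)
    then show "(\<Sum>i<m. (ip (basis i) x)\<^sup>2) = 1"
      by (simp add: ip_basis)
  qed
  also have "\<dots> = 1" by (simp add: prob_space)
  finally show ?thesis using m_ge2 by (simp add: field_simps)
qed

text \<open>Almost all mass lies near the equator of \<open>z\<close>. This bound is where large
  \<open>m\<close> pays off.\<close>

lemma prob_ip_ge_le:
  fixes s :: real
  assumes "z \<in> S" "s > 0"
  shows "prob {x \<in> S. s \<le> \<bar>ip z x\<bar>} \<le> 1 / (m * s\<^sup>2)"
proof -
  define E where "E = {x \<in> S. s \<le> \<bar>ip z x\<bar>}"
  have E[measurable]: "E \<in> sets N"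
    unfolding E_def space_N[symmetric] by measurable
  have "prob E = (\<integral>x. indicator E x \<partial>N)" by simp
  also have "\<dots> \<le> (\<integral>x. (ip z x)\<^sup>2 / s\<^sup>2 \<partial>N)"
  proof (intro integral_mono)
    show "integrable N (\<lambda>x. (ip z x)\<^sup>2 / s\<^sup>2)"
      using assms abs_ip_le[OF assms(1)]
      by (intro integrable_const_bound[of _ "1 / s\<^sup>2"])
          (auto simp: space_N abs_square_le_1 divide_right_mono)
    show "indicator E x \<le> (ip z x)\<^sup>2 / s\<^sup>2" for x
      using assms abs_le_square_iff[of s "ip z x"] by (auto simp: E_def indicator_def field_simps)
  qed (auto simp: emeasure_eq_measure)
  also have "\<dots> = 1 / (m * s\<^sup>2)" using integral_ip_sq[OF assms(1)] by simp
  finally show ?thesis by (simp add: E_def)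
qed

section \<open>Orthogonal directions and great circles\<close>

text \<open>One Gram-Schmidt step: \<open>e\<close> is the normalized component of \<open>y\<close>
  orthogonal to \<open>z\<close>, that is, the point of the equator of \<open>z\<close> nearest to
  \<open>y\<close>.\<close>

lemma orthogonal_decomposition:
  assumes "z \<in> S" "y \<in> S" "\<bar>ip z y\<bar> < 1"
  obtains e where "e \<in> S" "ip z e = 0" "ip y e = sqrt (1 - (ip z y)\<^sup>2)"
    "\<And>x. ip y x = ip z y * ip z x + sqrt (1 - (ip z y)\<^sup>2) * ip e x"
proof -
  define t where "t = ip z y"
  define q where "q = sqrt (1 - t\<^sup>2)"
  have q: "q > 0" "q\<^sup>2 = 1 - t\<^sup>2"
    using assms(3) by (auto simp: q_def t_def abs_square_less_1 abs_square_le_1)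
  define e where "e = lincomb (1 / q) y (- t / q) z"
  have *: "ip e x = (ip y x - t * ip z x) / q" for x
    using q by (simp add: e_def ip_lincomb diff_divide_distrib)
  have "e \<in> S"
    unfolding e_def using assms q
    by (intro lincomb_in_sphere)
       (simp add: ip_sphere ip_commute[of y z] t_def[symmetric] power_divide field_simps
           power2_eq_square)
  moreover have "ip z e = 0"
    unfolding ip_commute[of z e] * using assms by (simp add: ip_sphere t_def ip_commute)
  moreover have "ip y e = q"
    unfolding ip_commute[of y e] * using assms q
      by (simp add: ip_sphere t_def[symmetric] field_simps power2_eq_square)
  moreover have "ip y x = t * ip z x + q * ip e x" for x
    using q by (simp add: * )
  ultimately show ?thesis
    using that unfolding q_def t_def by blast
qed

text \<open>The first two basis vectors cannot both be parallel to \<open>z\<close>, since two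
  coordinates of modulus at least \<open>R\<close> would exceed the norm of
  \<open>z\<close>.\<close>

lemma ex_orthogonal:
  assumes "z \<in> S"
  obtains e where "e \<in> S" "ip z e = 0"
proof -
  have "\<exists>i<2. \<bar>ip z (basis i)\<bar> < 1"
  proof (rule ccontr)
    assume "\<not> ?thesis"
    then have "1 \<le> \<bar>ip (basis i) z\<bar>" if "i < 2" for i
      using that by (metis ip_commute not_less)
    from this[of 0] this[of 1] have "\<bar>z 0 / R\<bar> \<ge> 1" "\<bar>z 1 / R\<bar> \<ge> 1"
      using m_ge2 by (simp_all add: ip_basis)
    then have "(z 0 / R)\<^sup>2 \<ge> 1" "(z 1 / R)\<^sup>2 \<ge> 1"
      using abs_le_square_iff[of 1 "z 0 / R"] abs_le_square_iff[of 1 "z 1 / R"] by simp_all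
    moreover have "(\<Sum>i\<in>{0,1}. (z i / R)\<^sup>2) \<le> (\<Sum>i<m. (z i / R)\<^sup>2)"
      using m_ge2 by (intro sum_mono2) auto
    moreover have "(\<Sum>i<m. (z i / R)\<^sup>2) = 1"
      using ip_sphere[OF assms] by (simp add: ip_def power2_eq_square)
    ultimately show False by simp
  qed
  then obtain i where "i < m" "\<bar>ip z (basis i)\<bar> < 1"
    using m_ge2 by (metis order_less_le_trans)
  then show ?thesis
    using orthogonal_decomposition[OF assms basis_in_sphere] that by metis
qed

lemma great_circle_in_sphere:
  assumes "z \<in> S" "e \<in> S" "ip z e = 0"
  shows "lincomb (cos a) z (sin a) e \<in> S"
  using assms by (intro lincomb_in_sphere) (simp add: ip_sphere)

text \<open>
  The vectors \<open>e + j f\<close>, normalized, have levels of equal probability, and a point outside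
  \<open>e\<^sup>\<bottom> \<inter> f\<^sup>\<bottom>\<close> lies on at most two of these levels, because \<open>j\<close> is a root of a nonzero quadratic.
\<close>

lemma prob_ip_eq_le:
  assumes e: "e \<in> S" "f \<in> S" "ip e f = 0" and z: "z \<in> S"
  shows "prob {x \<in> S. ip z x = s} \<le> prob {x \<in> S. ip e x = 0 \<and> ip f x = 0}"
proof (rule ccontr)
  define q where "q = prob {x \<in> S. ip z x = s}"
  define p where "p = prob {x \<in> S. ip e x = 0 \<and> ip f x = 0}"
  assume "\<not> ?thesis"
  then have pq: "p < q" by (simp add: p_def q_def)
  define g where "g = (\<lambda>j::nat. lincomb (1 / sqrt (1 + (real j)\<^sup>2)) e (j / sqrt (1 + (real j)\<^sup>2)) f)"
  have pos: "sqrt (1 + (real j)\<^sup>2) > 0" for j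
    by (simp add: add_pos_nonneg)
  have gS: "g j \<in> S" for j
    unfolding g_def using e pos[of j]
    by (intro lincomb_in_sphere)
        (simp add: ip_sphere power_divide add_divide_distrib[symmetric] add_pos_nonneg
        less_imp_neq[symmetric])
  define E where "E = (\<lambda>j. {x \<in> S. ip (g j) x = s})"
  define Z where "Z = {x \<in> S. ip e x = 0 \<and> ip f x = 0}"
  have [measurable]: "E j \<in> sets N" "Z \<in> sets N" for j
    unfolding E_def Z_def space_N[symmetric] by measurable
  have PE: "prob (E j) = q" for j
    using prob_ip_eq[OF gS z, of "{s}"] by (simp add: E_def q_def)
  \<comment> \<open>Outside \<open>Z\<close> at most two levels contain the point; on
    \<open>Z\<close> the trivial bound \<open>n\<close> is used.\<close>
  have count: "(\<Sum>j<n. indicator (E j) x :: real) \<le> 2 + n * (indicator Z x :: real)"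
    if "x \<in> S" for n and x
  proof (cases "x \<in> Z")
    case True
    then show ?thesis
      using sum_mono[of "{..<n}" "\<lambda>j. indicator (E j) x" "\<lambda>_. 1::real"] by simp
  next
    case False
    \<comment> \<open>Squaring the equation of the level \<open>E j\<close> and clearing the
      normalization of \<open>g j\<close> makes \<open>j\<close> a root of this polynomial.\<close>
    define P where "P = [:(ip e x)\<^sup>2 - s\<^sup>2, 2 * ip e x * ip f x, (ip f x)\<^sup>2 - s\<^sup>2:]"
    have "P \<noteq> 0"
    proof
      assume "P = 0"
      then have "(ip e x)\<^sup>2 = s\<^sup>2" "(ip f x)\<^sup>2 = s\<^sup>2" "ip e x * ip f x = 0"
        by (auto simp: P_def)
      then have "ip e x = 0" "ip f x = 0" by auto
      then show False using False that by (simp add: Z_def)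
    qed
    have root: "poly P (real j) = 0" if "x \<in> E j" for j
    proof -
      have "ip e x + j * ip f x = s * sqrt (1 + (real j)\<^sup>2)"
        using that pos[of j] by (simp add: E_def g_def ip_lincomb field_simps)
      then have "(ip e x + j * ip f x)\<^sup>2 = s\<^sup>2 * (1 + (real j)\<^sup>2)"
        by (simp add: power_mult_distrib)
      then show ?thesis by (simp add: P_def power2_eq_square algebra_simps)
    qed
    have "card (real ` {j\<in>{..<n}. x \<in> E j}) \<le> card {t. poly P t = 0}"
      using root by (intro card_mono poly_roots_finite \<open>P \<noteq> 0\<close>) auto
    also have "\<dots> \<le> degree P" by (rule card_poly_roots_bound[OF \<open>P \<noteq> 0\<close>])
    also have "\<dots> \<le> 2" by (simp add: P_def)
    finally have "card {j\<in>{..<n}. x \<in> E j} \<le> 2"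
      by (simp add: card_image)
    moreover have "(\<Sum>j<n. indicator (E j) x) = real (card {j\<in>{..<n}. x \<in> E j})"
      by (simp add: indicator_def sum.If_cases Int_def)
    ultimately show ?thesis using False by simp
  qed
  \<comment> \<open>Integrating the count gives a bound linear in \<open>n\<close>, which
    contradicts \<open>p < q\<close> for large \<open>n\<close>.\<close>
  have "n * q \<le> 2 + n * p" for n :: nat
  proof -
    have "n * q = (\<integral>x. (\<Sum>j<n. indicator (E j) x) \<partial>N)"
      by (subst Bochner_Integration.integral_sum) (auto simp: PE emeasure_eq_measure)
    also have "\<dots> \<le> (\<integral>x. 2 + n * (indicator Z x :: real) \<partial>N)"
      using count by (intro integral_mono) (auto simp: space_N emeasure_eq_measure)
    also have "\<dots> = 2 + n * p"
      using \<open>Z \<in> sets N\<close>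
      by (subst Bochner_Integration.integral_add)
         (auto simp: emeasure_eq_measure Z_def[symmetric] p_def prob_space)
    finally show ?thesis .
  qed
  moreover obtain n :: nat where "n * (q - p) > 2"
    using ex_less_of_nat_mult[of "q - p" 2] pq by auto
  ultimately show False by (simp add: algebra_simps, meson not_less)
qed

text \<open>Comparing the equator \<open>Y\<close> with its own slices \<open>Z i\<close> shows that
  almost every point of \<open>Y\<close> lies in each \<open>Z i\<close>, hence has all coordinates
  0, which no point of the sphere has. So \<open>Y\<close> is null, and every other level is bounded
  by a slice of \<open>Y\<close>.\<close>

lemma prob_ip_level_0:
  assumes "z \<in> S"
  shows "prob {x \<in> S. ip z x = s} = 0"
proof -
  have 0: "0 < m" using m_ge2 by simp
  have orth: "ip (basis 0) (basis i) = 0" if "0 < i" "i < m" for i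
    using that 0 by (simp add: ip_basis) (simp add: basis_def)
  define Z where "Z = (\<lambda>i. {x \<in> S. ip (basis 0) x = 0 \<and> ip (basis i) x = 0})"
  define Y where "Y = {x \<in> S. ip (basis 0) x = 0}"
  have [measurable]: "Z i \<in> sets N" "Y \<in> sets N" for i
    unfolding Z_def Y_def space_N[symmetric] by measurable
  have "prob (Y - Z i) = 0" if "i < m" for i
  proof (cases "i = 0")
    case True
    then show ?thesis by (simp add: Y_def Z_def)
  next
    case False
    then have "prob Y \<le> prob (Z i)"
      unfolding Y_def Z_def using that 0
      by (intro prob_ip_eq_le basis_in_sphere orth) auto
    moreover have "Z i \<subseteq> Y" by (auto simp: Z_def Y_def)
    ultimately show ?thesis
      by (subst finite_measure_Diff) (auto simp: finite_measure_mono antisym)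
  qed
  then have "(\<Union>i<m. Y - Z i) \<in> null_sets N"
    by (intro null_sets_UN') (auto simp: null_sets_def emeasure_eq_measure)
  moreover have "Y \<subseteq> (\<Union>i<m. Y - Z i)"
  proof
    fix x assume x: "x \<in> Y"
    show "x \<in> (\<Union>i<m. Y - Z i)"
    proof (rule ccontr)
      assume "\<not> ?thesis"
      then have "\<forall>i<m. x i / R = 0" using x by (auto simp: Z_def ip_basis)
      then have "ip x x = 0" unfolding ip_def by (intro sum.neutral) simp
      then show False using x by (simp add: Y_def ip_sphere)
    qed
  qed
  ultimately have "Y \<in> null_sets N" by (intro null_sets_subset[of _ N Y]) auto
  then have Y0: "prob Y = 0" by (simp add: null_sets_def emeasure_eq_measure)
  have "prob {x \<in> S. ip z x = s} \<le> prob (Z 1)"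
    unfolding Z_def using m_ge2 assms by (intro prob_ip_eq_le basis_in_sphere orth) auto
  also have "\<dots> \<le> prob Y"
    by (rule finite_measure_mono[OF _ \<open>Y \<in> sets N\<close>]) (auto simp: Z_def Y_def)
  finally show ?thesis using Y0 by (simp add: measure_le_0_iff)
qed

text \<open>Since levels are null, the distribution function of \<open>ip z\<close> is continuous
  and the intermediate value theorem applies.\<close>

lemma ex_cap_prob:
  assumes z: "z \<in> S" and p: "0 \<le> p" "p \<le> 1"
  obtains a where "- 1 \<le> a" "a \<le> 1" "prob {x \<in> S. a \<le> ip z x} = p"
proof -
  define D where "D = distr N borel (ip z)"
  interpret D: real_distribution D
    unfolding D_def by (rule real_distribution_distr) simp
  have D: "measure D B = prob {x \<in> S. ip z x \<in> B}" if "B \<in> sets borel" for B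
    using that unfolding D_def
      by (subst measure_distr)
      (auto simp: space_N vimage_def Int_def intro!: arg_cong[where f=prob])
  have cont: "isCont (cdf D) a" for a
    unfolding D.isCont_cdf using prob_ip_level_0[OF z] by (simp add: D)
  have lo: "cdf D (- 1) = 0"
  proof -
    have "{x \<in> S. ip z x \<in> {.. - 1}} = {x \<in> S. ip z x = - 1}"
      using abs_ip_le[OF z] by force
    then show ?thesis using prob_ip_level_0[OF z] by (simp add: cdf_def D)
  qed
  have hi: "cdf D 1 = 1"
  proof -
    have "{x \<in> S. ip z x \<in> {.. 1}} = S" using abs_ip_le[OF z] by force
    then show ?thesis using prob_space by (simp add: cdf_def D space_N)
  qed
  \<comment> \<open>The value is \<open>1 - p\<close> because the distribution function measures the
    complement of the cap.\<close>
  obtain a where a: "- 1 \<le> a" "a \<le> 1" "cdf D a = 1 - p"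
    using IVT[of "cdf D" "-1" "1-p" 1] p cont lo hi by auto
  have "prob {x \<in> S. ip z x < a} = 1 - p"
  proof -
    have "prob {x \<in> S. ip z x \<le> a} = prob ({x \<in> S. ip z x < a} \<union> {x \<in> S. ip z x = a})"
      by (intro arg_cong[where f=prob]) auto
    also have "\<dots> = prob {x \<in> S. ip z x < a} + prob {x \<in> S. ip z x = a}"
      by (intro finite_measure_Union) (unfold space_N[symmetric], measurable, auto)
    finally show ?thesis using a(3) prob_ip_level_0[OF z] by (simp add: cdf_def D)
  qed
  moreover have "prob {x \<in> S. a \<le> ip z x} = 1 - prob {x \<in> S. ip z x < a}"
  proof -
    have m: "{x \<in> S. ip z x < a} \<in> sets N" unfolding space_N[symmetric] by measurable
    have "{x \<in> S. a \<le> ip z x} = space N - {x \<in> S. ip z x < a}" by (auto simp: space_N)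
    then show ?thesis using prob_compl[OF m] by simp
  qed
  ultimately show ?thesis using a that by simp
qed

text \<open>The band contains a small cap around a point \<open>w\<close> at its middle level
  \<open>c\<close>; the quarter width \<open>d\<close> keeps that cap strictly below
  \<open>b\<close>.\<close>

lemma prob_band_pos:
  assumes z: "z \<in> S" and a: "- 1 < a" "a < b" "b \<le> 1"
  shows "prob {x \<in> S. a \<le> ip z x \<and> ip z x < b} > 0"
proof -
  define c where "c = (a + b) / 2"
  define d where "d = (b - a) / 4"
  obtain e where e: "e \<in> S" "ip z e = 0" using ex_orthogonal[OF z] by blast
  define w where "w = lincomb (cos (arccos c)) z (sin (arccos c)) e"
  have c: "-1 \<le> c" "c \<le> 1" using a by (auto simp: c_def)
  have w: "w \<in> S" "ip z w = c"
    unfolding w_def using great_circle_in_sphere[OF z e, of "arccos c"] c z e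
    by (auto simp: ip_lincomb ip_sphere)
  have d: "d > 0" using a by (simp add: d_def)
  have "{x \<in> S. 1 - d\<^sup>2 / 2 \<le> ip w x} \<subseteq> {x \<in> S. a \<le> ip z x \<and> ip z x < b}"
  proof safe
    fix x assume "x \<in> S" "1 - d\<^sup>2 / 2 \<le> ip w x"
    then have "\<bar>ip z x - c\<bar> \<le> d"
      using ip_close[OF z w(1), of x d] d w(2) by auto
    then have "ip z x \<le> c + d" "c - d \<le> ip z x" by auto
    then show "a \<le> ip z x" "ip z x < b" using a unfolding c_def d_def by (simp_all add: field_simps)
  qed
  moreover have "{x \<in> S. a \<le> ip z x \<and> ip z x < b} \<in> sets N"
    unfolding space_N[symmetric] by measurable
  ultimately have "prob {x \<in> S. 1 - d\<^sup>2 / 2 \<le> ip w x} \<le> prob {x \<in> S. a \<le> ip z x \<and> ip z x < b}"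
    by (intro finite_measure_mono)
  moreover have "prob {x \<in> S. 1 - d\<^sup>2 / 2 \<le> ip w x} > 0"
    using d by (intro prob_cap_pos w) simp
  ultimately show ?thesis by simp
qed

section \<open>Approximation of sets by uniformly continuous functions\<close>

definition unit_fun :: "((nat \<Rightarrow> real) \<Rightarrow> real) \<Rightarrow> bool" where
  "unit_fun f \<longleftrightarrow> f \<in> borel_measurable N \<and> (\<forall>x\<in>S. 0 \<le> f x \<and> f x \<le> 1)"

lemma unit_funD:
  assumes "unit_fun f"
  shows "f \<in> borel_measurable N" "x \<in> S \<Longrightarrow> 0 \<le> f x" "x \<in> S \<Longrightarrow> f x \<le> 1"
  using assms by (auto simp: unit_fun_def)

lemma integrable_unit: "unit_fun f \<Longrightarrow> integrable N f"
  by (rule integrable_const_bound[of _ 1]) (auto simp: unit_fun_def space_N)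

lemma unit_fun_indicator: "A \<in> sets N \<Longrightarrow> unit_fun (indicator A)"
  by (auto simp: unit_fun_def indicator_def)

text \<open>Uniform continuity, with closeness expressed by the inner product instead of the
  distance, since reflections act on the former directly.\<close>

definition sphere_ucont :: "((nat \<Rightarrow> real) \<Rightarrow> real) \<Rightarrow> bool" where
  "sphere_ucont f \<longleftrightarrow>
    (\<forall>\<eta>>0. \<exists>\<rho>>0. \<forall>x\<in>S. \<forall>y\<in>S. 1 - \<rho> \<le> ip x y \<longrightarrow> \<bar>f x - f y\<bar> \<le> \<eta>)"

text \<open>Approximation in the mean. The lemmas below show closure under complements and countable
  unions, so that half-spaces suffice to reach every measurable set.\<close>

definition approximable :: "(nat \<Rightarrow> real) set \<Rightarrow> bool" where
  "approximable A \<longleftrightarrow> A \<in> sets N \<and>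
    (\<forall>\<kappa>>0. \<exists>f. unit_fun f \<and> sphere_ucont f \<and> (\<integral>x. \<bar>f x - indicator A x\<bar> \<partial>N) \<le> \<kappa>)"

lemma approximableE:
  assumes "approximable A" "\<kappa> > 0"
  obtains f where "unit_fun f" "sphere_ucont f" "(\<integral>x. \<bar>f x - indicator A x\<bar> \<partial>N) \<le> \<kappa>"
  using assms unfolding approximable_def by blast

lemma integrable_diff_indicator:
  "unit_fun f \<Longrightarrow> A \<in> sets N \<Longrightarrow> integrable N (\<lambda>x. \<bar>f x - indicator A x\<bar>)"
  using integrable_unit unit_fun_indicator
    by (intro integrable_abs Bochner_Integration.integrable_diff) auto

lemma sphere_ucont_max:
  assumes "sphere_ucont f" "sphere_ucont g"
  shows "sphere_ucont (\<lambda>x. max (f x) (g x))"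
  unfolding sphere_ucont_def
proof (intro allI impI)
  fix \<eta> :: real assume "\<eta> > 0"
  then obtain r s where rs: "r > 0" "s > 0"
    "\<And>x y. x \<in> S \<Longrightarrow> y \<in> S \<Longrightarrow> 1 - r \<le> ip x y \<Longrightarrow> \<bar>f x - f y\<bar> \<le> \<eta>"
    "\<And>x y. x \<in> S \<Longrightarrow> y \<in> S \<Longrightarrow> 1 - s \<le> ip x y \<Longrightarrow> \<bar>g x - g y\<bar> \<le> \<eta>"
    using assms unfolding sphere_ucont_def by metis
  have "\<bar>max (f x) (g x) - max (f y) (g y)\<bar> \<le> \<eta>"
    if "x \<in> S" "y \<in> S" "1 - min r s \<le> ip x y" for x y
  proof -
    have "\<bar>f x - f y\<bar> \<le> \<eta>" "\<bar>g x - g y\<bar> \<le> \<eta>"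
      using rs(3)[OF that(1,2)] rs(4)[OF that(1,2)] that(3) by (auto simp: min_def split: if_splits)
    then show ?thesis by linarith
  qed
  then show "\<exists>\<rho>>0. \<forall>x\<in>S. \<forall>y\<in>S. 1 - \<rho> \<le> ip x y \<longrightarrow> \<bar>max (f x) (g x) - max (f y) (g y)\<bar> \<le> \<eta>"
    using rs(1,2) by (intro exI[of _ "min r s"]) auto
qed

lemma approximable_Un:
  assumes "approximable A" "approximable B"
  shows "approximable (A \<union> B)"
  unfolding approximable_def
proof (intro conjI allI impI)
  have AB[measurable]: "A \<in> sets N" "B \<in> sets N" using assms by (auto simp: approximable_def)
  then show "A \<union> B \<in> sets N" by simp
  fix \<kappa> :: real assume "\<kappa> > 0"
  then have half: "\<kappa> / 2 > 0" by simp
  obtain f where f: "unit_fun f" "sphere_ucont f" "(\<integral>x. \<bar>f x - indicator A x\<bar> \<partial>N) \<le> \<kappa> / 2"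
    by (rule approximableE[OF assms(1) half])
  obtain g where g: "unit_fun g" "sphere_ucont g" "(\<integral>x. \<bar>g x - indicator B x\<bar> \<partial>N) \<le> \<kappa> / 2"
    by (rule approximableE[OF assms(2) half])
  have m: "unit_fun (\<lambda>x. max (f x) (g x))"
    using f(1) g(1) by (auto simp: unit_fun_def le_max_iff_disj)
  have pw: "\<bar>max (f x) (g x) - indicator (A \<union> B) x\<bar> \<le> \<bar>f x - indicator A x\<bar> + \<bar>g x - indicator B x\<bar>"
    if "x \<in> S" for x
  proof -
    have "\<bar>max a b - max c d\<bar> \<le> \<bar>a - c\<bar> + \<bar>b - d\<bar>" for a b c d :: real by linarith
    moreover have "indicator (A \<union> B) x = max (indicator A x) (indicator B x :: real)"
      by (auto simp: indicator_def)
    ultimately show ?thesis by simp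
  qed
  have "(\<integral>x. \<bar>max (f x) (g x) - indicator (A \<union> B) x\<bar> \<partial>N)
      \<le> (\<integral>x. \<bar>f x - indicator A x\<bar> + \<bar>g x - indicator B x\<bar> \<partial>N)"
    using f(1) g(1) m AB pw
    by (intro integral_mono integrable_diff_indicator Bochner_Integration.integrable_add)
       (auto simp: space_N)
  also have "\<dots> \<le> \<kappa>"
    using f g AB by (subst Bochner_Integration.integral_add)
        (auto intro!: integrable_diff_indicator)
  finally show "\<exists>f. unit_fun f \<and> sphere_ucont f \<and> (\<integral>x. \<bar>f x - indicator (A \<union> B) x\<bar> \<partial>N) \<le> \<kappa>"
    using m sphere_ucont_max[OF f(2) g(2)] by blast
qed

lemma approximable_Diff:
  assumes "approximable A"
  shows "approximable (S - A)"
  unfolding approximable_def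
proof (intro conjI allI impI)
  have A: "A \<in> sets N" using assms by (auto simp: approximable_def)
  then show "S - A \<in> sets N" by (simp add: space_N[symmetric])
  fix \<kappa> :: real assume "\<kappa> > 0"
  then obtain f where f: "unit_fun f" "sphere_ucont f" "(\<integral>x. \<bar>f x - indicator A x\<bar> \<partial>N) \<le> \<kappa>"
    by (rule approximableE[OF assms])
  have "(\<integral>x. \<bar>1 - f x - indicator (S - A) x\<bar> \<partial>N) = (\<integral>x. \<bar>f x - indicator A x\<bar> \<partial>N)"
    by (intro Bochner_Integration.integral_cong) (auto simp: space_N indicator_def)
  moreover have "unit_fun (\<lambda>x. 1 - f x)" "sphere_ucont (\<lambda>x. 1 - f x)"
    using f by (auto simp: unit_fun_def sphere_ucont_def abs_minus_commute)
  ultimately show "\<exists>f. unit_fun f \<and> sphere_ucont f \<and> (\<integral>x. \<bar>f x - indicator (S - A) x\<bar> \<partial>N) \<le> \<kappa>"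
    using f(3) by (intro exI[of _ "\<lambda>x. 1 - f x"]) auto
qed

lemma approximable_empty: "approximable {}"
  unfolding approximable_def
  by (auto intro!: exI[of _ "\<lambda>_. 0"] exI[of _ 1] simp: unit_fun_def sphere_ucont_def)

text \<open>By continuity from below a finite union misses at most \<open>\<kappa> / 2\<close> of
  the whole one; the other half of the error is spent on approximating that finite union.\<close>

lemma approximable_UN:
  fixes A :: "nat \<Rightarrow> (nat \<Rightarrow> real) set"
  assumes "\<And>i. approximable (A i)"
  shows "approximable (\<Union>i. A i)"
  unfolding approximable_def
proof (intro conjI allI impI)
  have A[measurable]: "A i \<in> sets N" for i using assms by (auto simp: approximable_def)
  then show U: "(\<Union>i. A i) \<in> sets N" by auto
  define U where "U = (\<lambda>n. \<Union>i<n. A i)"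
  have Ua: "approximable (U n)" for n
  proof (induction n)
    case 0
    then show ?case using approximable_empty by (simp add: U_def)
  next
    case (Suc n)
    have "U (Suc n) = U n \<union> A n" by (auto simp: U_def less_Suc_eq)
    then show ?case using approximable_Un[OF Suc assms] by simp
  qed
  have Um: "U n \<in> sets N" for n using Ua by (simp add: approximable_def)
  fix \<kappa> :: real assume "\<kappa> > 0"
  have "(\<lambda>n. prob (U n)) \<longlonglongrightarrow> prob (\<Union>n. U n)"
    using Um by (intro finite_Lim_measure_incseq)
        (auto simp: incseq_def U_def intro: order_less_le_trans)
  moreover have "(\<Union>n. U n) = (\<Union>i. A i)" by (auto simp: U_def)
  ultimately obtain n where "\<bar>prob (U n) - prob (\<Union>i. A i)\<bar> < \<kappa> / 2"
    using \<open>\<kappa> > 0\<close> unfolding LIMSEQ_iff by (metis half_gt_zero order_refl real_norm_def)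
  moreover have "prob ((\<Union>i. A i) - U n) = prob (\<Union>i. A i) - prob (U n)"
    using Um U by (intro finite_measure_Diff) (auto simp: U_def)
  ultimately have n: "prob ((\<Union>i. A i) - U n) \<le> \<kappa> / 2" by linarith
  obtain f where f: "unit_fun f" "sphere_ucont f" "(\<integral>x. \<bar>f x - indicator (U n) x\<bar> \<partial>N) \<le> \<kappa> / 2"
    using approximableE[OF Ua[of n], of "\<kappa> / 2"] \<open>\<kappa> > 0\<close> by (metis half_gt_zero)
  have "(\<integral>x. \<bar>f x - indicator (\<Union>i. A i) x\<bar> \<partial>N)
      \<le> (\<integral>x. \<bar>f x - indicator (U n) x\<bar> + indicator ((\<Union>i. A i) - U n) x \<partial>N)"
    using f U Um
    by (intro integral_mono integrable_diff_indicator Bochner_Integration.integrable_add)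
       (auto simp: emeasure_eq_measure, auto simp: indicator_def U_def)
  also have "\<dots> = (\<integral>x. \<bar>f x - indicator (U n) x\<bar> \<partial>N) + prob ((\<Union>i. A i) - U n)"
    using f U Um
    by (subst Bochner_Integration.integral_add)
       (auto intro!: integrable_diff_indicator simp: emeasure_eq_measure)
  also have "\<dots> \<le> \<kappa>" using f(3) n by simp
  finally show "\<exists>f. unit_fun f \<and> sphere_ucont f \<and> (\<integral>x. \<bar>f x - indicator (\<Union>i. A i) x\<bar> \<partial>N) \<le> \<kappa>"
    using f by blast
qed

text \<open>The cut-off \<open>f n\<close> is 1 on the half-space and, for positive
  \<open>n\<close>, drops linearly to 0 over a width of \<open>1 / n\<close>. Dominated convergence
  makes the error small.\<close>

lemma approximable_halfspace:
  assumes i: "i < m"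
  shows "approximable {x \<in> S. x i \<le> a}"
  unfolding approximable_def
proof (intro conjI allI impI)
  define A where "A = {x \<in> S. x i \<le> a}"
  show A[measurable]: "{x \<in> S. x i \<le> a} \<in> sets N"
    using i unfolding space_N[symmetric] by measurable
  define f where "f = (\<lambda>(n::nat) (x::nat \<Rightarrow> real). max 0 (min 1 (1 - n * (x i - a))))"
  have u: "unit_fun (f n)" for n
    using i by (auto simp: unit_fun_def f_def)
  have "(\<lambda>n. \<integral>x. \<bar>f n x - indicator A x\<bar> \<partial>N) \<longlonglongrightarrow> (\<integral>x. 0 \<partial>N)"
  proof (rule integral_dominated_convergence[where w = "\<lambda>_. 1"])
    show "AE x in N. (\<lambda>n. \<bar>f n x - indicator A x\<bar>) \<longlonglongrightarrow> 0"
    proof (rule AE_I2)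
      fix x assume x: "x \<in> space N"
      have "\<forall>\<^sub>F n in sequentially. \<bar>f n x - indicator A x\<bar> = 0"
      proof (cases "x i \<le> a")
        case True
        have "f n x = 1" for n
          using True mult_nonneg_nonpos[of "real n" "x i - a"] by (simp add: f_def)
        then show ?thesis using True x by (simp add: A_def space_N)
      next
        case False
        then obtain k where k: "1 < real k * (x i - a)" using ex_less_of_nat_mult[of "x i - a" 1]
          by auto
        have "f n x = 0" if "n \<ge> k" for n
        proof -
          have "real k * (x i - a) \<le> real n * (x i - a)"
            using that False by (intro mult_right_mono) auto
          then show ?thesis using k by (simp add: f_def)
        qed
        then show ?thesis using False by (auto simp: A_def eventually_sequentially)
      qed
      then show "(\<lambda>n. \<bar>f n x - indicator A x\<bar>) \<longlonglongrightarrow> 0"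
        by (rule tendsto_eventually)
    qed
    show "AE x in N. norm \<bar>f n x - indicator A x\<bar> \<le> 1" for n
      by (auto simp: f_def indicator_def)
  next
    show "(\<lambda>x. \<bar>f n x - indicator A x\<bar>) \<in> borel_measurable N" for n
      using A unit_funD(1)[OF u[of n]] unfolding A_def[symmetric] by measurable
  qed auto
  then have lim: "(\<lambda>n. \<integral>x. \<bar>f n x - indicator A x\<bar> \<partial>N) \<longlonglongrightarrow> 0" by simp
  fix \<kappa> :: real assume "\<kappa> > 0"
  then obtain n where "\<forall>k\<ge>n. norm ((\<integral>x. \<bar>f k x - indicator A x\<bar> \<partial>N) - 0) < \<kappa>"
    using LIMSEQ_D[OF lim] by blast
  then have n: "(\<integral>x. \<bar>f n x - indicator A x\<bar> \<partial>N) \<le> \<kappa>"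
    by (auto dest!: spec[of _ n])
  have "sphere_ucont (f n)"
    unfolding sphere_ucont_def
  proof (intro allI impI)
    fix \<eta> :: real assume \<eta>: "\<eta> > 0"
    \<comment> \<open>A coordinate changes by at most \<open>R * e\<close>, and \<open>f n\<close>
      has Lipschitz constant \<open>n\<close>; adding 1 to \<open>n\<close> avoids a zero
      denominator.\<close>
    define e where "e = \<eta> / (R * (real n + 1))"
    have e: "e > 0" using \<eta> R_pos by (simp add: e_def)
    have "\<bar>f n x - f n y\<bar> \<le> \<eta>" if "x \<in> S" "y \<in> S" "1 - e\<^sup>2 / 2 \<le> ip x y" for x y
    proof -
      have "\<bar>ip (basis i) y - ip (basis i) x\<bar> \<le> e"
        using that e by (intro ip_close basis_in_sphere i) auto
      then have "\<bar>y i - x i\<bar> \<le> R * e"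
        using R_pos i by (simp add: ip_basis diff_divide_distrib[symmetric] field_simps)
      then have "real n * \<bar>y i - x i\<bar> \<le> (real n + 1) * (R * e)"
        using R_pos e by (intro mult_mono) auto
      also have "\<dots> = \<eta>" using R_pos by (simp add: e_def)
      finally have "\<bar>real n * (y i - x i)\<bar> \<le> \<eta>"
        by (simp add: abs_mult)
      moreover have "real n * (y i - x i) = n * (y i - a) - n * (x i - a)" by algebra
      ultimately have "\<bar>n * (y i - a) - n * (x i - a)\<bar> \<le> \<eta>" by simp
      then show ?thesis unfolding f_def by linarith
    qed
    then show "\<exists>\<rho>>0. \<forall>x\<in>S. \<forall>y\<in>S. 1 - \<rho> \<le> ip x y \<longrightarrow> \<bar>f n x - f n y\<bar> \<le> \<eta>"
      using e by (intro exI[of _ "e\<^sup>2 / 2"]) auto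
  qed
  then show "\<exists>f. unit_fun f \<and> sphere_ucont f \<and> (\<integral>x. \<bar>f x - indicator {x \<in> S. x i \<le> a} x\<bar> \<partial>N) \<le> \<kappa>"
    using u n unfolding A_def by blast
qed

lemma approximable_coordinate:
  assumes i: "i < m" and "B \<in> sets borel"
  shows "approximable {x \<in> S. x i \<in> B}"
proof -
  have "B \<in> sigma_sets UNIV (range (\<lambda>a. {..a::real}))"
    using assms(2) by (simp add: borel_eq_atMost)
  then show ?thesis
  proof induction
    case (Basic B)
    then show ?case using approximable_halfspace[OF i] by auto
  next
    case (Compl B)
    have "{x \<in> S. x i \<in> UNIV - B} = S - {x \<in> S. x i \<in> B}" by auto
    then show ?case using approximable_Diff[OF Compl.IH] by simp
  next
    case (Union B)
    have "{x \<in> S. x i \<in> (\<Union>k. B k)} = (\<Union>k. {x \<in> S. x i \<in> B k})" by auto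
    then show ?case using approximable_UN[OF Union.IH] by simp
  qed (simp add: approximable_empty)
qed

lemma sets_approximable:
  assumes "A \<in> sets N"
  shows "approximable A"
proof -
  obtain B where B: "B \<in> sets (Pi\<^sub>M {..<m} (\<lambda>_. borel :: real measure))" "A = S \<inter> B"
    using assms unfolding sets_N sets_restrict_space by auto
  have S_sub: "S \<subseteq> (\<Pi>\<^sub>E i\<in>{..<m}. space borel)" by (auto simp: euc_sphere_def)
  have "approximable (S \<inter> B)"
    using B(1) unfolding sets_PiM_single
  proof induction
    case (Basic B)
    then obtain i C where iC: "i < m" "C \<in> sets borel"
      "B = {f \<in> \<Pi>\<^sub>E i\<in>{..<m}. space borel. f i \<in> C}" by auto
    then have "S \<inter> B = {x \<in> S. x i \<in> C}" using S_sub by auto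
    then show ?case using approximable_coordinate[OF iC(1,2)] by simp
  next
    case (Compl B)
    have "S \<inter> ((\<Pi>\<^sub>E i\<in>{..<m}. space borel) - B) = S - (S \<inter> B)" using S_sub by auto
    then show ?case using approximable_Diff[OF Compl.IH] by simp
  next
    case (Union B)
    have "S \<inter> (\<Union>k. B k) = (\<Union>k. S \<inter> B k)" by auto
    then show ?case using approximable_UN[OF Union.IH] by simp
  qed (simp add: approximable_empty)
  then show ?thesis using B(2) by simp
qed

lemma integral_indicator_eq: "B \<in> sets N \<Longrightarrow> (\<integral>x. indicator B x \<partial>N) = prob B"
  using sets.sets_into_space[of B N] by (simp add: Int_absorb2)

section \<open>Polarization\<close>

definition polarize :: "(nat \<Rightarrow> real) \<Rightarrow> ((nat \<Rightarrow> real) \<Rightarrow> real) \<Rightarrow> (nat \<Rightarrow> real) \<Rightarrow> real" where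
  "polarize u f x =
    (if 0 \<le> ip u x then max (f x) (f (reflect u x)) else min (f x) (f (reflect u x)))"

lemma reflect_fixed: "x \<in> S \<Longrightarrow> ip u x = 0 \<Longrightarrow> reflect u x = x"
  unfolding reflect_def
  by (rule extensionalityI[of _ "{..<m}"]) (auto simp: sphere_iff lincomb_def)

text \<open>Reflection flips the sign of \<open>ip u x\<close>; if that is 0, the point is its own
  mirror image and maximum and minimum coincide.\<close>

lemma polarize_reflect:
  assumes "x \<in> S"
  shows "polarize u f (reflect u x) =
    (if 0 \<le> ip u x then min (f x) (f (reflect u x)) else max (f x) (f (reflect u x)))"
  using assms reflect_fixed[OF assms, of u]
  by (cases "ip u x = 0")
      (auto simp: polarize_def ip_reflect_axis reflect_reflect max.commute min.commute)

lemma polarize_pair: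
  assumes "x \<in> S"
  shows "(polarize u f x = f x \<and> polarize u f (reflect u x) = f (reflect u x)) \<or>
    (polarize u f x = f (reflect u x) \<and> polarize u f (reflect u x) = f x)"
  unfolding polarize_reflect[OF assms] by (auto simp: polarize_def max_def min_def)

lemma polarize_unit: "unit_fun f \<Longrightarrow> unit_fun (polarize u f)"
  unfolding unit_fun_def
proof safe
  assume [measurable]: "f \<in> borel_measurable N"
  show "polarize u f \<in> borel_measurable N"
    unfolding polarize_def[abs_def] by measurable
qed (use reflect_in_sphere in \<open>auto simp: polarize_def max_def min_def\<close>)

text \<open>By invariance the integral is half the integral of the sum over a mirror pair, and
  polarization only permutes the two values of a pair.\<close>

lemma integral_polarize:
  fixes \<phi> :: "real \<Rightarrow> real"
  assumes f: "unit_fun f" and \<phi>[measurable]: "\<phi> \<in> borel_measurable borel"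
    and bd: "\<And>t. 0 \<le> t \<Longrightarrow> t \<le> 1 \<Longrightarrow> \<bar>\<phi> t\<bar> \<le> 1"
  shows "(\<integral>x. \<phi> (polarize u f x) \<partial>N) = (\<integral>x. \<phi> (f x) \<partial>N)"
proof -
  have *: "integrable N (\<lambda>x. \<phi> (g x))" "integrable N (\<lambda>x. \<phi> (g (reflect u x)))"
    "2 * (\<integral>x. \<phi> (g x) \<partial>N) = (\<integral>x. \<phi> (g x) + \<phi> (g (reflect u x)) \<partial>N)" if g: "unit_fun g" for g
  proof -
    have [measurable]: "g \<in> borel_measurable N" using g by (simp add: unit_fun_def)
    show i: "integrable N (\<lambda>x. \<phi> (g x))"
      using g bd by (intro integrable_const_bound[of _ 1]) (auto simp: unit_fun_def space_N)
    show i': "integrable N (\<lambda>x. \<phi> (g (reflect u x)))"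
      using g bd reflect_in_sphere
        by (intro integrable_const_bound[of _ 1]) (auto simp: unit_fun_def space_N)
    show "2 * (\<integral>x. \<phi> (g x) \<partial>N) = (\<integral>x. \<phi> (g x) + \<phi> (g (reflect u x)) \<partial>N)"
      using integral_reflect[of "\<lambda>x. \<phi> (g x)" u] i i' by simp
  qed
  have "(\<integral>x. \<phi> (polarize u f x) + \<phi> (polarize u f (reflect u x)) \<partial>N)
      = (\<integral>x. \<phi> (f x) + \<phi> (f (reflect u x)) \<partial>N)"
  proof (intro Bochner_Integration.integral_cong refl)
    fix x assume "x \<in> space N"
    then show "\<phi> (polarize u f x) + \<phi> (polarize u f (reflect u x)) = \<phi> (f x) + \<phi> (f (reflect u x))"
      using polarize_pair[of x u f] by (auto simp: space_N)
  qed
  then show ?thesis using *(3)[OF f] *(3)[OF polarize_unit[OF f, of u]] by simp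
qed

text \<open>Continuity at one scale, a form that polarization preserves with the same
  \<open>\<rho>\<close>. The value 1/16 is chosen so that a violation of monotonicity by 1/4 still
  leaves 1/8 after both points are moved.\<close>

definition cont_scale :: "real \<Rightarrow> ((nat \<Rightarrow> real) \<Rightarrow> real) \<Rightarrow> bool" where
  "cont_scale \<rho> f \<longleftrightarrow> (\<forall>x\<in>S. \<forall>y\<in>S. 1 - \<rho> \<le> ip x y \<longrightarrow> \<bar>f x - f y\<bar> \<le> 1 / 16)"

text \<open>If \<open>x\<close> and \<open>y\<close> are on the same side, maxima are compared with
  maxima or minima with minima. On opposite sides \<open>x\<close> is at least as close to the
  mirror image of \<open>y\<close> as to \<open>y\<close>, so all four cross differences are
  small.\<close>

lemma polarize_cont_scale:
  assumes f: "cont_scale \<rho> f"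
  shows "cont_scale \<rho> (polarize u f)"
  unfolding cont_scale_def
proof (intro ballI impI)
  fix x y assume xy: "x \<in> S" "y \<in> S" "1 - \<rho> \<le> ip x y"
  define x' y' where "x' = reflect u x" and "y' = reflect u y"
  have S': "x' \<in> S" "y' \<in> S" using xy by (auto simp: x'_def y'_def reflect_in_sphere)
  have 1: "\<bar>f x - f y\<bar> \<le> 1 / 16" using f xy by (simp add: cont_scale_def)
  have 2: "\<bar>f x' - f y'\<bar> \<le> 1 / 16"
    using f xy S' by (simp add: cont_scale_def x'_def y'_def ip_reflect_reflect)
  show "\<bar>polarize u f x - polarize u f y\<bar> \<le> 1 / 16"
  proof (cases "0 \<le> ip u x \<longleftrightarrow> 0 \<le> ip u y")
    case True
    then show ?thesis
      using 1 2 unfolding polarize_def x'_def[symmetric] y'_def[symmetric]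
      by (smt (verit))
  next
    case False
    then have "ip u x * ip u y \<le> 0" by (auto simp: mult_le_0_iff)
    then have "ip x y \<le> ip x y'"
      using ip_nonneg[of u] by (simp add: y'_def ip_reflect divide_nonpos_nonneg mult.assoc)
    then have 3: "\<bar>f x - f y'\<bar> \<le> 1 / 16" "\<bar>f x' - f y\<bar> \<le> 1 / 16"
      using f xy S' by (auto simp: cont_scale_def x'_def y'_def ip_reflect_left)
    show ?thesis
      using False 1 2 3 unfolding polarize_def x'_def[symmetric] y'_def[symmetric]
      by (smt (verit))
  qed
qed

section \<open>The double integral and its growth under polarization\<close>

definition kern :: "real \<Rightarrow> (nat \<Rightarrow> real) \<Rightarrow> (nat \<Rightarrow> real) \<Rightarrow> real" where
  "kern c x y = (if c \<le> ip x y then 1 else 0)"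

definition energy :: "real \<Rightarrow> ((nat \<Rightarrow> real) \<Rightarrow> real) \<Rightarrow> ((nat \<Rightarrow> real) \<Rightarrow> real) \<Rightarrow> real" where
  "energy c f h = (\<integral>p. f (fst p) * h (snd p) * kern c (fst p) (snd p) \<partial>(N \<Otimes>\<^sub>M N))"

lemma kern_measurable [measurable]:
  "(\<lambda>p. kern c (fst p) (snd p)) \<in> borel_measurable (N \<Otimes>\<^sub>M N)"
  "(\<lambda>y. kern c x y) \<in> borel_measurable N" "(\<lambda>y. kern c y x) \<in> borel_measurable N"
proof -
  have [measurable]: "(\<lambda>p. ip (fst p) (snd p)) \<in> borel_measurable (N \<Otimes>\<^sub>M N)"
    by (intro ip_measurable_pair) auto
  show "(\<lambda>p. kern c (fst p) (snd p)) \<in> borel_measurable (N \<Otimes>\<^sub>M N)"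
    unfolding kern_def by measurable
qed (unfold kern_def, measurable)

lemma kern_unit: "0 \<le> kern c x y" "kern c x y \<le> 1"
  by (auto simp: kern_def)

sublocale P: pair_prob_space N N ..

lemma space_pair: "space (N \<Otimes>\<^sub>M N) = S \<times> S"
  by (simp add: space_pair_measure space_N)

lemma energy_integrable:
  assumes "unit_fun f" "unit_fun h"
  shows "integrable (N \<Otimes>\<^sub>M N) (\<lambda>p. f (fst p) * h (snd p) * kern c (fst p) (snd p))"
proof (rule P.integrable_const_bound[of _ 1])
  show "AE p in N \<Otimes>\<^sub>M N. norm (f (fst p) * h (snd p) * kern c (fst p) (snd p)) \<le> 1"
  proof (rule AE_I2)
    fix p assume "p \<in> space (N \<Otimes>\<^sub>M N)"
    then have "0 \<le> f (fst p)" "f (fst p) \<le> 1" "0 \<le> h (snd p)" "h (snd p) \<le> 1"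
      using assms by (auto simp: space_pair unit_fun_def)
    then show "norm (f (fst p) * h (snd p) * kern c (fst p) (snd p)) \<le> 1"
      using kern_unit[of c "fst p" "snd p"] by (simp add: mult_le_one)
  qed
qed (use assms in \<open>auto simp: unit_fun_def\<close>)

text \<open>Two separate maps are allowed because the variables must be reflected independently of
  each other.\<close>

lemma integral_pair_reflect:
  fixes \<phi> :: "_ \<Rightarrow> real"
  assumes a: "a \<in> measurable N N" "distr N N a = N" and b: "b \<in> measurable N N" "distr N N b = N"
    and \<phi>: "integrable (N \<Otimes>\<^sub>M N) \<phi>"
  shows "integrable (N \<Otimes>\<^sub>M N) (\<lambda>p. \<phi> (a (fst p), b (snd p)))"
    "(\<integral>p. \<phi> (a (fst p), b (snd p)) \<partial>(N \<Otimes>\<^sub>M N)) = (\<integral>p. \<phi> p \<partial>(N \<Otimes>\<^sub>M N))"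
proof -
  have ab[measurable]: "(\<lambda>(x, y). (a x, b y)) \<in> measurable (N \<Otimes>\<^sub>M N) (N \<Otimes>\<^sub>M N)"
    using a b by measurable
  have d: "distr (N \<Otimes>\<^sub>M N) (N \<Otimes>\<^sub>M N) (\<lambda>(x, y). (a x, b y)) = N \<Otimes>\<^sub>M N"
    using pair_measure_distr[OF a(1) b(1)] a b sigma_finite_measure_axioms by simp
  show "(\<integral>p. \<phi> (a (fst p), b (snd p)) \<partial>(N \<Otimes>\<^sub>M N)) = (\<integral>p. \<phi> p \<partial>(N \<Otimes>\<^sub>M N))"
    using integral_distr[OF ab borel_measurable_integrable[OF \<phi>], unfolded d]
    by (simp add: case_prod_unfold)
  show "integrable (N \<Otimes>\<^sub>M N) (\<lambda>p. \<phi> (a (fst p), b (snd p)))"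
    using integrable_distr[OF ab, of \<phi>, unfolded d, OF \<phi>] by (simp add: case_prod_unfold)
qed

text \<open>Averaging over reflecting neither, both or one of the variables reduces inequalities
  between energies to pointwise inequalities on four pairs of points.\<close>

lemma energy_four:
  fixes c :: real and u :: "nat \<Rightarrow> real"
  assumes f: "unit_fun f" and h: "unit_fun h"
  defines "G \<equiv> \<lambda>p. f (fst p) * h (snd p) * kern c (fst p) (snd p)"
  defines "s \<equiv> reflect u"
  shows "integrable (N \<Otimes>\<^sub>M N)
      (\<lambda>p. G p + G (s (fst p), s (snd p)) + G (fst p, s (snd p)) + G (s (fst p), snd p))"
    "4 * energy c f h = (\<integral>p. G p + G (s (fst p), s (snd p)) + G (fst p, s (snd p))
        + G (s (fst p), snd p) \<partial>(N \<Otimes>\<^sub>M N))"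
proof -
  have i: "integrable (N \<Otimes>\<^sub>M N) G" unfolding G_def by (rule energy_integrable[OF f h])
  have s: "s \<in> measurable N N" "distr N N s = N" by (auto simp: s_def distr_reflect)
  have id: "(\<lambda>x. x) \<in> measurable N N" "distr N N (\<lambda>x. x) = N" by (auto simp: distr_id)
  note r = integral_pair_reflect[OF s s i] integral_pair_reflect[OF id s i]
    integral_pair_reflect[OF s id i]
  show "integrable (N \<Otimes>\<^sub>M N)
      (\<lambda>p. G p + G (s (fst p), s (snd p)) + G (fst p, s (snd p)) + G (s (fst p), snd p))"
    using i r by (intro Bochner_Integration.integrable_add) auto
  show "4 * energy c f h
      = (\<integral>p. G p + G (s (fst p), s (snd p)) + G (fst p, s (snd p))
      + G (s (fst p), snd p) \<partial>(N \<Otimes>\<^sub>M N))"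
    using i r unfolding energy_def G_def[symmetric] by simp
qed

text \<open>On the four pairs the kernel takes only two values: \<open>k\<close> for points both
  kept or both reflected, and \<open>k'\<close> for mixed pairs. If both functions keep or both
  exchange their values, the sum is unchanged; otherwise it grows by the product estimated
  below.\<close>

lemma energy_polarize:
  assumes f: "unit_fun f" and h: "unit_fun h"
  shows "energy c f h \<le> energy c (polarize u f) (polarize u h)"
proof -
  define s where "s = reflect u"
  note four = energy_four[of _ _ c u, folded s_def]
  have "4 * energy c f h \<le> 4 * energy c (polarize u f) (polarize u h)"
    unfolding four(2)[OF f h] four(2)[OF polarize_unit[OF f] polarize_unit[OF h]]
  proof (intro integral_mono four(1) f h polarize_unit)
    fix p assume "p \<in> space (N \<Otimes>\<^sub>M N)"
    then obtain x y where p: "p = (x, y)" "x \<in> S" "y \<in> S" by (auto simp: space_pair)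
    define a a' b b' where ab: "a = f x" "a' = f (s x)" "b = h y" "b' = h (s y)"
    define A A' B B' where AB: "A = polarize u f x" "A' = polarize u f (s x)"
      "B = polarize u h y" "B' = polarize u h (s y)"
    define k k' where k: "k = kern c x y" "k' = kern c x (s y)"
    have k2: "kern c (s x) (s y) = k" "kern c (s x) y = k'"
      by (simp_all only: k kern_def s_def ip_reflect_reflect ip_reflect_left[of u x y])
    have pa: "(A = a \<and> A' = a') \<or> (A = a' \<and> A' = a)"
      using polarize_pair[OF p(2), of u f] by (simp add: AB ab s_def)
    have pb: "(B = b \<and> B' = b') \<or> (B = b' \<and> B' = b)"
      using polarize_pair[OF p(3), of u h] by (simp add: AB ab s_def)
    have sa: "if 0 \<le> ip u x then A' \<le> A else A \<le> A'"
      unfolding AB s_def polarize_reflect[OF p(2)] by (simp add: polarize_def)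
    have sb: "if 0 \<le> ip u y then B' \<le> B else B \<le> B'"
      unfolding AB s_def polarize_reflect[OF p(3)] by (simp add: polarize_def)
    \<comment> \<open>For \<open>x\<close> and \<open>y\<close> on the same side \<open>k'\<close>
      is at most \<open>k\<close> and both differences have the same sign; on opposite sides both
      relations are reversed.\<close>
    have "0 \<le> (k - k') * ((A - A') * (B - B'))"
    proof (cases "0 \<le> ip u x \<longleftrightarrow> 0 \<le> ip u y")
      case True
      then have "0 \<le> ip u x * ip u y" by (auto simp: zero_le_mult_iff)
      then have "ip x (s y) \<le> ip x y"
        using ip_nonneg[of u] by (simp add: s_def ip_reflect mult.assoc)
      then have "k' \<le> k" by (simp add: k kern_def)
      moreover have "0 \<le> (A - A') * (B - B')"
        using True sa sb by (auto simp: zero_le_mult_iff split: if_splits)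
      ultimately show ?thesis by simp
    next
      case False
      then have "ip u x * ip u y \<le> 0" by (auto simp: mult_le_0_iff)
      then have "ip x y \<le> ip x (s y)"
        using ip_nonneg[of u] by (simp add: s_def ip_reflect divide_nonpos_nonneg mult.assoc)
      then have "k \<le> k'" by (simp add: k kern_def)
      moreover have "(A - A') * (B - B') \<le> 0"
        using False sa sb by (auto simp: mult_le_0_iff split: if_splits)
      ultimately show ?thesis by (simp add: mult_nonpos_nonpos)
    qed
    then have "a * b * k + a' * b' * k + a * b' * k' + a' * b * k'
        \<le> A * B * k + A' * B' * k + A * B' * k' + A' * B * k'"
      using pa pb by (elim disjE conjE) (simp_all add: algebra_simps)
    then show "f (fst p) * h (snd p) * kern c (fst p) (snd p) +
         f (fst (s (fst p), s (snd p))) * h (snd (s (fst p), s (snd p))) * kern c (fst (s (fst p),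
             s (snd p))) (snd (s (fst p), s (snd p))) +
         f (fst (fst p, s (snd p))) * h (snd (fst p, s (snd p))) * kern c (fst (fst p, s (snd p)))
             (snd (fst p, s (snd p))) +
         f (fst (s (fst p), snd p)) * h (snd (s (fst p), snd p)) * kern c (fst (s (fst p), snd p))
             (snd (s (fst p), snd p))
      \<le> polarize u f (fst p) * polarize u h (snd p) * kern c (fst p) (snd p) +
         polarize u f (fst (s (fst p), s (snd p))) * polarize u h (snd (s (fst p), s (snd p))) *
             kern c (fst (s (fst p), s (snd p))) (snd (s (fst p), s (snd p))) +
         polarize u f (fst (fst p, s (snd p))) * polarize u h (snd (fst p, s (snd p))) * kern c
             (fst (fst p, s (snd p))) (snd (fst p, s (snd p))) +
         polarize u f (fst (s (fst p), snd p)) * polarize u h (snd (s (fst p), snd p)) * kern c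
             (fst (s (fst p), snd p)) (snd (s (fst p), snd p))"
      unfolding p(1) fst_conv snd_conv k2 ab[symmetric] AB[symmetric] k[symmetric] .
  qed
  then show ?thesis by simp
qed

section \<open>Riesz rearrangement\<close>

definition moment :: "(nat \<Rightarrow> real) \<Rightarrow> ((nat \<Rightarrow> real) \<Rightarrow> real) \<Rightarrow> real" where
  "moment z f = (\<integral>x. f x * ip z x \<partial>N)"

lemma integrable_unit_ip:
  assumes "unit_fun f" "z \<in> S"
  shows "integrable N (\<lambda>x. f x * ip z x)" "integrable N (\<lambda>x. f (reflect u x) * ip z (reflect u x))"
proof -
  have [measurable]: "f \<in> borel_measurable N" using assms by (simp add: unit_fun_def)
  have "\<bar>f x * ip z x\<bar> \<le> 1" if "x \<in> S" for x
    using assms abs_ip_le[OF assms(2) that] that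
      by (auto simp: abs_mult unit_fun_def intro!: mult_le_one)
  then show "integrable N (\<lambda>x. f x * ip z x)" "integrable N (\<lambda>x. f (reflect u x) * ip z (reflect u
      x))"
    by (auto intro!: integrable_const_bound[of _ 1] simp: space_N reflect_in_sphere)
qed

lemma moment_le_1: "unit_fun f \<Longrightarrow> z \<in> S \<Longrightarrow> moment z f \<le> 1"
proof -
  assume f: "unit_fun f" and z: "z \<in> S"
  have "f x * ip z x \<le> 1" if "x \<in> S" for x
  proof -
    have "\<bar>f x * ip z x\<bar> \<le> 1"
      using f abs_ip_le[OF z that] that by (auto simp: abs_mult unit_fun_def intro!: mult_le_one)
    then show ?thesis by simp
  qed
  then show ?thesis
    unfolding moment_def using f z
    by (intro integral_le_const integrable_unit_ip AE_I2) (auto simp: space_N)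
qed

lemma ip_diff_reflect: "ip z x - ip z (reflect u x) = 2 * ip u z * ip u x / ip u u"
  by (simp add: ip_reflect)

text \<open>Pairing \<open>x\<close> with its mirror image turns the increase of the moment into
  half an integral of \<open>D x * (ip z x - ip z (reflect u x))\<close>. Neither factor has the
  sign opposite to that of \<open>ip u x\<close>, so the integrand is nonnegative, and on
  \<open>B\<close> it is at least \<open>g\<close>.\<close>

lemma moment_polarize_gain:
  assumes f: "unit_fun f" and z: "z \<in> S" and B: "B \<in> sets N"
    and pos: "0 \<le> ip u z" and g: "0 \<le> g"
    and gain: "\<And>x. x \<in> B \<Longrightarrow> g \<le> (polarize u f x - f x) * (ip z x - ip z (reflect u x))"
  shows "moment z f + g * prob B / 2 \<le> moment z (polarize u f)"
proof -
  note pu = polarize_unit[OF f, of u]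
  define D where "D = (\<lambda>x. polarize u f x - f x)"
  have D': "D (reflect u x) = - D x" if "x \<in> S" for x
    using polarize_pair[OF that, of u f] by (auto simp: D_def)
  have i: "integrable N (\<lambda>x. D x * ip z x)" "integrable N (\<lambda>x. D (reflect u x) * ip z (reflect u
      x))"
    unfolding D_def left_diff_distrib
    using integrable_unit_ip[OF f z] integrable_unit_ip[OF pu z] by auto
  have [measurable]: "f \<in> borel_measurable N" "polarize u f \<in> borel_measurable N"
    using f pu by (auto simp: unit_fun_def)
  have "moment z (polarize u f) - moment z f = (\<integral>x. D x * ip z x \<partial>N)"
    unfolding moment_def D_def left_diff_distrib
    using integrable_unit_ip[OF f z] integrable_unit_ip[OF pu z] by simp
  moreover have "(\<integral>x. D (reflect u x) * ip z (reflect u x) \<partial>N) = (\<integral>x. D x * ip z x \<partial>N)"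
    by (rule integral_reflect) (simp add: D_def)
  ultimately have "2 * (moment z (polarize u f) - moment z f)
      = (\<integral>x. D x * ip z x + D (reflect u x) * ip z (reflect u x) \<partial>N)"
    using i by simp
  also have "\<dots> \<ge> (\<integral>x. g * indicator B x \<partial>N)"
  proof (intro integral_mono Bochner_Integration.integrable_add i)
    show "integrable N (\<lambda>x. g * indicator B x)" using B by (simp add: emeasure_eq_measure)
    fix x assume "x \<in> space N"
    then have x: "x \<in> S" by (simp add: space_N)
    have eq: "D x * ip z x + D (reflect u x) * ip z (reflect u x)
        = D x * (ip z x - ip z (reflect u x))"
      by (simp add: D'[OF x] algebra_simps)
    have "0 \<le> D x * (ip z x - ip z (reflect u x))"
    proof (cases "0 \<le> ip u x")
      case True
      then show ?thesis
        using pos ip_nonneg[of u] by (auto simp: D_def polarize_def ip_diff_reflect)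
    next
      case False
      then have "D x \<le> 0" "ip z x - ip z (reflect u x) \<le> 0"
        using pos ip_nonneg[of u]
        by (auto simp: D_def polarize_def ip_diff_reflect mult_nonneg_nonpos divide_nonpos_nonneg)
      then show ?thesis by (simp add: mult_nonpos_nonpos)
    qed
    then show "g * indicator B x \<le> D x * ip z x + D (reflect u x) * ip z (reflect u x)"
      unfolding eq using gain[of x] by (auto simp: indicator_def D_def)
  qed
  finally show ?thesis using B by (simp add: emeasure_eq_measure)
qed

text \<open>The reflection swaps \<open>x0\<close> and \<open>y0\<close>. For \<open>x\<close> near
  \<open>x0\<close> the mirror image is near \<open>y0\<close>, so polarization raises the value by
  at least 1/8 at a point whose level exceeds that of its image by \<open>\<tau> / 2\<close>; half
  the product is \<open>\<tau> / 32\<close>.\<close>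

lemma moment_gain:
  assumes f: "unit_fun f" "cont_scale \<rho> f" and z: "z \<in> S" and \<tau>: "\<tau> > 0"
    and x0: "x0 \<in> S" and y0: "y0 \<in> S" and lt: "ip z y0 + \<tau> \<le> ip z x0" "f x0 < f y0 - 1 / 4"
  defines "u \<equiv> lincomb 1 x0 (- 1) y0"
  shows "0 \<le> ip u z"
    "moment z f + \<tau> / 32 * prob {x \<in> S. 1 - min \<rho> (\<tau>\<^sup>2 / 32) \<le> ip z x} \<le> moment z (polarize u f)"
proof -
  have uz: "ip u z = ip z x0 - ip z y0" by (simp add: u_def ip_lincomb ip_commute[of z])
  then show uz0: "0 \<le> ip u z" using lt \<tau> by simp
  have uu: "ip u u = 2 - 2 * ip x0 y0" "ip u x0 = ip u u / 2"
    using x0 y0 by (auto simp: u_def ip_lincomb ip_sphere ip_commute[of y0 x0])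
  have "\<tau>\<^sup>2 \<le> (ip u z)\<^sup>2" using uz lt \<tau> by (intro power_mono) auto
  also have "\<dots> \<le> ip u u" using Cauchy_Schwarz_ip[of u z] z by (simp add: ip_sphere)
  finally have uu2: "\<tau>\<^sup>2 \<le> ip u u" .
  then have uupos: "ip u u > 0" using \<tau> by (smt (verit) zero_less_power)
  \<comment> \<open>The radius makes \<open>x - x0\<close> at most a quarter as long as
    \<open>u\<close>, so \<open>ip u x\<close> stays at least half of
    \<open>ip u x0\<close>.\<close>
  define B where "B = {x \<in> S. 1 - min \<rho> (\<tau>\<^sup>2 / 32) \<le> ip x0 x}"
  have B: "B \<in> sets N" unfolding B_def space_N[symmetric] by measurable
  have "moment z f + \<tau> / 16 * prob B / 2 \<le> moment z (polarize u f)"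
  proof (rule moment_polarize_gain[OF f(1) z B uz0])
    fix x assume "x \<in> B"
    then have x: "x \<in> S" "1 - \<rho> \<le> ip x0 x" "1 - \<tau>\<^sup>2 / 32 \<le> ip x0 x" by (auto simp: B_def)
    have "(ip u (lincomb 1 x (- 1) x0))\<^sup>2 \<le> ip u u * (2 - 2 * ip x0 x)"
      using Cauchy_Schwarz_ip[of u "lincomb 1 x (- 1) x0"] x x0
      by (simp add: ip_lincomb ip_sphere ip_commute[of x x0])
    also have "\<dots> \<le> ip u u * (ip u u / 16)"
      using x(3) uu2 uupos by (intro mult_left_mono) auto
    finally have "(ip u x - ip u x0)\<^sup>2 \<le> (ip u u / 4)\<^sup>2"
      by (simp add: ip_lincomb power2_eq_square)
    then have "\<bar>ip u x - ip u x0\<bar> \<le> ip u u / 4"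
      using uupos by (simp add: abs_le_square_iff[symmetric])
    then have ux: "ip u u / 4 \<le> ip u x" using uu(2) by linarith
    have "\<tau> / 2 = 2 * \<tau> * (ip u u / 4) / ip u u" using uupos by simp
    also have "\<dots> \<le> 2 * ip u z * ip u x / ip u u"
      using uupos ux uz lt \<tau> by (intro divide_right_mono mult_mono) auto
    finally have d: "\<tau> / 2 \<le> ip z x - ip z (reflect u x)" by (simp add: ip_diff_reflect)
    have r: "reflect u x \<in> S" using x by (simp add: reflect_in_sphere)
    have "reflect u x0 = y0" unfolding u_def by (rule reflect_swap[OF x0 y0])
    then have "1 - \<rho> \<le> ip y0 (reflect u x)"
      using x(2) ip_reflect_reflect[of u x0 x] by simp
    then have "\<bar>f y0 - f (reflect u x)\<bar> \<le> 1 / 16" "\<bar>f x0 - f x\<bar> \<le> 1 / 16"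
      using f(2) x r x0 y0 by (auto simp: cont_scale_def)
    then have "1 / 8 \<le> f (reflect u x) - f x" using lt(2) by linarith
    also have "\<dots> \<le> polarize u f x - f x" using ux uupos by (simp add: polarize_def)
    finally have "1 / 8 * (\<tau> / 2) \<le> (polarize u f x - f x) * (ip z x - ip z (reflect u x))"
      using d \<tau> by (intro mult_mono) auto
    then show "\<tau> / 16 \<le> (polarize u f x - f x) * (ip z x - ip z (reflect u x))" by simp
  qed (use \<tau> in simp)
  moreover have "prob B = prob {x \<in> S. 1 - min \<rho> (\<tau>\<^sup>2 / 32) \<le> ip z x}"
    using prob_ip_eq[OF x0 z, of "{1 - min \<rho> (\<tau>\<^sup>2 / 32)..}"] by (simp add: B_def)
  ultimately show "moment z f + \<tau> / 32 * prob {x \<in> S. 1 - min \<rho> (\<tau>\<^sup>2 / 32) \<le> ip z x}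
      \<le> moment z (polarize u f)"
    by simp
qed

text \<open>Both tolerances are fixed so that a failure supplies exactly the pair of points that
  \<open>moment_gain\<close> asks for.\<close>

definition almost_mono :: "(nat \<Rightarrow> real) \<Rightarrow> real \<Rightarrow> ((nat \<Rightarrow> real) \<Rightarrow> real) \<Rightarrow> bool" where
  "almost_mono z \<tau> f \<longleftrightarrow> (\<forall>x\<in>S. \<forall>y\<in>S. ip z y + \<tau> \<le> ip z x \<longrightarrow> f y - 1 / 4 \<le> f x)"

text \<open>
  Of equimeasurability only these two integrals are needed: the second one controls how far a
  \<open>[0, 1]\<close>-valued function is from an indicator.
\<close>

definition rearr :: "((nat \<Rightarrow> real) \<Rightarrow> real) \<Rightarrow> ((nat \<Rightarrow> real) \<Rightarrow> real) \<Rightarrow> bool" where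
  "rearr f g \<longleftrightarrow> (\<integral>x. f x \<partial>N) = (\<integral>x. g x \<partial>N) \<and>
    (\<integral>x. f x * (1 - f x) \<partial>N) = (\<integral>x. g x * (1 - g x) \<partial>N)"

lemma rearr_polarize:
  assumes "unit_fun f"
  shows "rearr (polarize u f) f"
  unfolding rearr_def
  using integral_polarize[OF assms, of "\<lambda>t. t" u] integral_polarize[OF assms, of "\<lambda>t. t * (1 - t)"
      u]
  by (simp add: mult_le_one abs_mult)

text \<open>Each failure of almost monotonicity in either function gives a reflection, which is
  applied to both. One moment gains at least \<open>g\<close>, the other does not drop, and
  \<open>g\<close> is the same in every round because \<open>\<rho>\<close> is preserved.\<close>

lemma ex_almost_mono:
  assumes f: "unit_fun f" "cont_scale \<rho> f" and h: "unit_fun h" "cont_scale \<rho> h"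
    and z: "z \<in> S" and \<tau>: "\<tau> > 0" and \<rho>: "\<rho> > 0"
  obtains f' h' where "unit_fun f'" "unit_fun h'" "rearr f' f" "rearr h' h"
    "energy c f h \<le> energy c f' h'" "almost_mono z \<tau> f'" "almost_mono z \<tau> h'"
proof (rule ccontr)
  note that' = that
  \<comment> \<open>The invariant of the iteration.\<close>
  define I where "I = (\<lambda>f' h'. unit_fun f' \<and> unit_fun h' \<and> cont_scale \<rho> f' \<and> cont_scale \<rho> h' \<and>
    rearr f' f \<and> rearr h' h \<and> energy c f h \<le> energy c f' h')"
  define g where "g = \<tau> / 32 * prob {x \<in> S. 1 - min \<rho> (\<tau>\<^sup>2 / 32) \<le> ip z x}"
  have g: "g > 0"
    unfolding g_def using \<tau> \<rho> z by (intro mult_pos_pos prob_cap_pos) auto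
  assume neg: "\<not> thesis"
  have polI: "I (polarize u f') (polarize u h')" if "I f' h'" for f' h' u
    using that rearr_polarize[of f' u] rearr_polarize[of h' u] energy_polarize[of f' h' c u]
    by (auto simp: I_def polarize_unit polarize_cont_scale rearr_def)
  have nondec: "moment z f' \<le> moment z (polarize u f')" if "unit_fun f'" "0 \<le> ip u z" for f' u
    using moment_polarize_gain[OF that(1) z, of "{}" u 0] that(2) by simp
  have step: "\<exists>f'' h''. I f'' h'' \<and> moment z f' + moment z h' + g \<le> moment z f'' + moment z h''"
    if I': "I f' h'" for f' h'
  proof -
    have u: "unit_fun f'" "unit_fun h'" "cont_scale \<rho> f'" "cont_scale \<rho> h'"
      using I' by (auto simp: I_def)
    have "\<not> (almost_mono z \<tau> f' \<and> almost_mono z \<tau> h')"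
      using neg that' I' unfolding I_def by blast
    then consider "\<not> almost_mono z \<tau> f'" | "\<not> almost_mono z \<tau> h'" by blast
    then show ?thesis
    proof cases
      case 1
      then obtain x y where xy: "x \<in> S" "y \<in> S" "ip z y + \<tau> \<le> ip z x" "f' x < f' y - 1 / 4"
        by (auto simp: almost_mono_def not_le)
      note mg = moment_gain[OF u(1,3) z \<tau> xy, folded g_def]
      show ?thesis
        by (rule exI, rule exI, rule conjI, rule polI[OF I', of "lincomb 1 x (- 1) y"])
           (use mg(2) nondec[OF u(2) mg(1)] in linarith)
    next
      case 2
      then obtain x y where xy: "x \<in> S" "y \<in> S" "ip z y + \<tau> \<le> ip z x" "h' x < h' y - 1 / 4"
        by (auto simp: almost_mono_def not_le)
      note mg = moment_gain[OF u(2,4) z \<tau> xy, folded g_def]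
      show ?thesis
        by (rule exI, rule exI, rule conjI, rule polI[OF I', of "lincomb 1 x (- 1) y"])
           (use mg(2) nondec[OF u(1) mg(1)] in linarith)
    qed
  qed
  have "I f h" using f h by (simp add: I_def rearr_def)
  have iter: "\<exists>f' h'. I f' h' \<and> moment z f + moment z h + n * g
      \<le> moment z f' + moment z h'" for n :: nat
  proof (induction n)
    case 0
    then show ?case using \<open>I f h\<close> by auto
  next
    case (Suc n)
    then obtain f' h' where I': "I f' h'" "moment z f + moment z h + n * g
        \<le> moment z f' + moment z h'" by blast
    obtain f'' h'' where I'': "I f'' h''" "moment z f' + moment z h' + g
        \<le> moment z f'' + moment z h''"
      using step[OF I'(1)] by blast
    have "moment z f + moment z h + Suc n * g \<le> moment z f'' + moment z h''"
      using I'(2) I''(2) by (simp add: algebra_simps)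
    then show ?case using I''(1) by blast
  qed
  \<comment> \<open>The two moments together cannot exceed 2.\<close>
  obtain n :: nat where n: "2 - (moment z f + moment z h) < n * g"
    using ex_less_of_nat_mult[OF g] by blast
  obtain f' h' where "I f' h'" "moment z f + moment z h + n * g \<le> moment z f' + moment z h'"
    using iter by blast
  moreover have "moment z f' \<le> 1" "moment z h' \<le> 1"
    using moment_le_1 z \<open>I f' h'\<close> by (auto simp: I_def)
  ultimately show False using n by linarith
qed

text \<open>A value above 1/2 far below level \<open>a\<close> would force \<open>f\<close> above
  1/4 on the enlarged cap \<open>X\<close>. As \<open>f\<close> is almost an indicator, its mean
  would then nearly reach \<open>prob X\<close>, contradicting \<open>mean\<close> and
  \<open>band\<close>. So \<open>f\<close> is at most 1/2 on the tail, where it is bounded by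
  \<open>2 * (f x * (1 - f x))\<close>.\<close>

lemma almost_mono_tail:
  assumes f: "unit_fun f" "almost_mono z \<tau> f" and z: "z \<in> S" and \<tau>: "\<tau> > 0"
    and mean: "(\<integral>x. f x \<partial>N) \<le> prob {x \<in> S. a \<le> ip z x} + \<kappa>"
    and var: "(\<integral>x. f x * (1 - f x) \<partial>N) \<le> \<kappa>"
    and band: "- 1 < a - \<tau> \<Longrightarrow> 5 * \<kappa> < prob {x \<in> S. a - \<tau> \<le> ip z x \<and> ip z x < a}"
  shows "(\<integral>x. f x * indicator {x \<in> S. ip z x < a - 2 * \<tau>} x \<partial>N) \<le> 2 * \<kappa>"
proof -
  have [measurable]: "f \<in> borel_measurable N" using f by (simp add: unit_fun_def)
  have sm: "{x \<in> S. P (ip z x)} \<in> sets N" if "Measurable.pred borel P" for P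
    using that unfolding space_N[symmetric] by measurable
  have iv: "integrable N (\<lambda>x. f x * (1 - f x))"
    using f by (intro integrable_const_bound[of _ 1])
        (auto simp: unit_fun_def space_N abs_mult mult_le_one)
  have half: "f x \<le> 1 / 2" if x: "x \<in> S" "ip z x < a - 2 * \<tau>" for x
  proof (rule ccontr)
    assume fx: "\<not> ?thesis"
    define X where "X = {x \<in> S. a - \<tau> \<le> ip z x}"
    have X: "X \<in> sets N" unfolding X_def by (rule sm) simp
    have "prob X - 4 * \<kappa> \<le> prob X - 4 * (\<integral>x. f x * (1 - f x) \<partial>N)" using var by simp
    also have "\<dots> = (\<integral>x. indicator X x - 4 * (f x * (1 - f x)) \<partial>N)"
      using X iv by (subst Bochner_Integration.integral_diff) (auto simp: emeasure_eq_measure)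
    also have "\<dots> \<le> (\<integral>x. f x \<partial>N)"
    proof (intro integral_mono Bochner_Integration.integrable_diff integrable_mult_right iv
        integrable_unit f(1))
      show "unit_fun (indicat_real X)" by (rule unit_fun_indicator[OF X])
      fix y assume "y \<in> space N"
      then have y: "y \<in> S" "0 \<le> f y" "f y \<le> 1" using f by (auto simp: unit_fun_def space_N)
      show "indicator X y - 4 * (f y * (1 - f y)) \<le> f y"
      proof (cases "y \<in> X")
        case True
        then have "f x - 1 / 4 \<le> f y"
          using f(2) x y \<tau> unfolding almost_mono_def X_def by auto
        then have "1 / 4 * (1 - f y) \<le> f y * (1 - f y)"
          using fx y by (intro mult_right_mono) auto
        then show ?thesis using True by simp
      next
        case False
        then have "indicator X y = (0 :: real)" by simp
        moreover have "0 \<le> f y * (1 - f y)" using y by simp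
        ultimately show ?thesis using y by linarith
      qed
    qed
    finally have "prob X \<le> prob {x \<in> S. a \<le> ip z x} + 5 * \<kappa>" using mean by simp
    moreover have "prob X = prob ({x \<in> S. a \<le> ip z x} \<union> {x \<in> S. a - \<tau> \<le> ip z x \<and> ip z x < a})"
      using \<tau> by (intro arg_cong[where f=prob]) (auto simp: X_def)
    then have "prob X = prob {x \<in> S. a \<le> ip z x} + prob {x \<in> S. a - \<tau> \<le> ip z x \<and> ip z x < a}"
      by (subst (asm) finite_measure_Union) (auto intro!: sm)
    \<comment> \<open>The point \<open>x\<close> of the tail has level at least -1, which places the
      band inside the sphere.\<close>
    moreover have "- 1 < a - \<tau>"
      using x \<tau> abs_ip_le[OF z x(1)] by linarith
    ultimately show False using band by simp
  qed
  have "(\<integral>x. f x * indicator {x \<in> S. ip z x < a - 2 * \<tau>} x \<partial>N) \<le> (\<integral>x. 2 * (f x * (1 - f x)) \<partial>N)"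
  proof (intro integral_mono integrable_mult_right iv)
    show "integrable N (\<lambda>x. f x * indicator {x \<in> S. ip z x < a - 2 * \<tau>} x)"
      using sm integrable_unit[OF f(1)] by (intro integrable_real_mult_indicator) auto
    fix x assume "x \<in> space N"
    then have x: "x \<in> S" "0 \<le> f x" "f x \<le> 1" using f by (auto simp: unit_fun_def space_N)
    have "f x * (1 / 2) \<le> f x * (1 - f x)" if "f x \<le> 1 / 2"
      using x that by (intro mult_left_mono) auto
    then show "f x * indicator {x \<in> S. ip z x < a - 2 * \<tau>} x \<le> 2 * (f x * (1 - f x))"
      using half[of x] x by (auto simp: indicator_def)
  qed
  also have "\<dots> \<le> 2 * \<kappa>" using var by simp
  finally show ?thesis .
qed

lemma integral_pair_fst_snd:
  assumes "unit_fun f"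
  shows "integrable (N \<Otimes>\<^sub>M N) (\<lambda>p. f (fst p))" "(\<integral>p. f (fst p) \<partial>(N \<Otimes>\<^sub>M N)) = (\<integral>x. f x \<partial>N)"
    "integrable (N \<Otimes>\<^sub>M N) (\<lambda>p. f (snd p))" "(\<integral>p. f (snd p) \<partial>(N \<Otimes>\<^sub>M N)) = (\<integral>x. f x \<partial>N)"
proof -
  have [measurable]: "f \<in> borel_measurable N" using assms by (simp add: unit_fun_def)
  show 1: "integrable (N \<Otimes>\<^sub>M N) (\<lambda>p. f (fst p))"
    using assms by (intro P.integrable_const_bound[of _ 1]) (auto simp: unit_fun_def space_pair)
  show 2: "integrable (N \<Otimes>\<^sub>M N) (\<lambda>p. f (snd p))"
    using assms by (intro P.integrable_const_bound[of _ 1]) (auto simp: unit_fun_def space_pair)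
  show "(\<integral>p. f (fst p) \<partial>(N \<Otimes>\<^sub>M N)) = (\<integral>x. f x \<partial>N)"
    using P.integral_fst'[OF 1] by (simp add: prob_space)
  show "(\<integral>p. f (snd p) \<partial>(N \<Otimes>\<^sub>M N)) = (\<integral>x. f x \<partial>N)"
    using P.integral_fst'[OF 2] by (simp add: prob_space)
qed

text \<open>The kernel is 0 or 1, so it cannot enlarge the errors, and each error depends on one
  variable only.\<close>

lemma energy_le_add:
  assumes u: "unit_fun f" "unit_fun h" "unit_fun f'" "unit_fun h'" "unit_fun \<phi>" "unit_fun \<psi>"
    and le: "\<And>x y. x \<in> S \<Longrightarrow> y \<in> S \<Longrightarrow> f x * h y \<le> f' x * h' y + \<phi> x + \<psi> y"
  shows "energy c f h \<le> energy c f' h' + (\<integral>x. \<phi> x \<partial>N) + (\<integral>x. \<psi> x \<partial>N)"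
proof -
  note i = energy_integrable[OF u(1,2), of c] energy_integrable[OF u(3,4), of c]
    integral_pair_fst_snd[OF u(5)] integral_pair_fst_snd[OF u(6)]
  have "energy c f h \<le> (\<integral>p. f' (fst p) * h' (snd p) * kern c (fst p)
      (snd p) + \<phi> (fst p) + \<psi> (snd p) \<partial>(N \<Otimes>\<^sub>M N))"
    unfolding energy_def
  proof (intro integral_mono Bochner_Integration.integrable_add i)
    fix p assume "p \<in> space (N \<Otimes>\<^sub>M N)"
    then have p: "fst p \<in> S" "snd p \<in> S" by (auto simp: space_pair)
    then have "0 \<le> \<phi> (fst p)" "0 \<le> \<psi> (snd p)" using u by (auto simp: unit_fun_def)
    then show "f (fst p) * h (snd p) * kern c (fst p) (snd p)
        \<le> f' (fst p) * h' (snd p) * kern c (fst p) (snd p) + \<phi> (fst p) + \<psi> (snd p)"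
      using le[OF p] by (simp add: kern_def)
  qed
  also have "\<dots> = energy c f' h' + (\<integral>x. \<phi> x \<partial>N) + (\<integral>x. \<psi> x \<partial>N)"
    using i by (simp add: energy_def)
  finally show ?thesis .
qed

text \<open>The bands are open at \<open>a\<close>, so they shrink to the empty set and continuity
  from above applies.\<close>

lemma thin_band:
  assumes "e > 0"
  obtains \<tau>0 where "\<tau>0 > 0"
    "\<And>\<tau>. 0 < \<tau> \<Longrightarrow> \<tau> \<le> \<tau>0 \<Longrightarrow> prob {x \<in> S. a - 2 * \<tau> \<le> ip z x \<and> ip z x < a} \<le> e"
proof -
  define X where "X = (\<lambda>t. {x \<in> S. a - 2 * t \<le> ip z x \<and> ip z x < a})"
  have X: "X t \<in> sets N" for t unfolding X_def space_N[symmetric] by measurable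
  have "(\<lambda>n. prob (X (1 / real (Suc n)))) \<longlonglongrightarrow> prob (\<Inter>n. X (1 / real (Suc n)))"
  proof (rule finite_Lim_measure_decseq)
    show "decseq (\<lambda>n. X (1 / real (Suc n)))"
      unfolding decseq_def
    proof (intro allI impI)
      fix i j :: nat assume "i \<le> j"
      then have "1 / real (Suc j) \<le> 1 / real (Suc i)" by (simp add: frac_le)
      then show "X (1 / real (Suc j)) \<subseteq> X (1 / real (Suc i))"
        unfolding X_def by (intro Collect_mono) linarith
    qed
  qed (use X in auto)
  also have "(\<Inter>n. X (1 / real (Suc n))) = {}"
  proof (rule ccontr)
    assume "\<not> ?thesis"
    then obtain x where x: "\<And>n. x \<in> X (1 / real (Suc n))" by blast
    then have "ip z x < a" by (auto simp: X_def)
    then obtain n where "1 / real (Suc n) < (a - ip z x) / 2"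
      using nat_approx_posE[of "(a - ip z x) / 2"] by auto
    moreover have "a - 2 * (1 / real (Suc n)) \<le> ip z x" using x[of n] by (simp add: X_def)
    ultimately show False by (simp add: field_simps)
  qed
  finally have "(\<lambda>n. prob (X (1 / real (Suc n)))) \<longlonglongrightarrow> 0" by simp
  then obtain n where n: "prob (X (1 / real (Suc n))) < e"
    using assms LIMSEQ_D[of "\<lambda>n. prob (X (1 / real (Suc n)))" 0 e] by (auto dest: spec)
  have "prob (X t) \<le> e" if "0 < t" "t \<le> 1 / real (Suc n)" for t
  proof -
    have "X t \<subseteq> X (1 / real (Suc n))" using that by (auto simp: X_def)
    then have "prob (X t) \<le> prob (X (1 / real (Suc n)))" using X by (intro finite_measure_mono)
    then show ?thesis using n by simp
  qed
  then show ?thesis using that[of "1 / real (Suc n)"] by (simp add: X_def)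
qed

text \<open>The sets are replaced by continuous functions, these by almost monotone ones, and these
  are bounded by caps enlarged by thin bands plus small tails.\<close>

theorem riesz_rearrangement:
  assumes A: "A \<in> sets N" and C: "C \<in> sets N" and z: "z \<in> S"
    and a: "a \<le> 1" "prob A = prob {x \<in> S. a \<le> ip z x}"
    and b: "b \<le> 1" "prob C = prob {x \<in> S. b \<le> ip z x}"
  shows "energy c (indicator A) (indicator C)
    \<le> energy c (indicator {x \<in> S. a \<le> ip z x}) (indicator {x \<in> S. b \<le> ip z x})"
proof (rule field_le_epsilon)
  fix e :: real assume e: "e > 0"
  have sm: "{x \<in> S. P (ip z x)} \<in> sets N" if "Measurable.pred borel P" for P
    using that unfolding space_N[symmetric] by measurable
  have e4: "e / 4 > 0" using e by simp
  obtain t1 where t1: "t1 > 0"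
    "\<And>\<tau>. 0 < \<tau> \<Longrightarrow> \<tau> \<le> t1 \<Longrightarrow> prob {x \<in> S. a - 2 * \<tau> \<le> ip z x \<and> ip z x < a} \<le> e / 4"
    using thin_band[OF e4, of a z] by blast
  obtain t2 where t2: "t2 > 0"
    "\<And>\<tau>. 0 < \<tau> \<Longrightarrow> \<tau> \<le> t2 \<Longrightarrow> prob {x \<in> S. b - 2 * \<tau> \<le> ip z x \<and> ip z x < b} \<le> e / 4"
    using thin_band[OF e4, of b z] by blast
  define \<tau> where "\<tau> = min t1 t2"
  have \<tau>: "\<tau> > 0" "\<tau> \<le> t1" "\<tau> \<le> t2" using t1 t2 by (auto simp: \<tau>_def)
  \<comment> \<open>The default 1 covers the case in which \<open>band\<close> of
    \<open>almost_mono_tail\<close> demands nothing.\<close>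
  define w where "w = (\<lambda>a. if - 1 < a - \<tau> then prob {x \<in> S. a - \<tau> \<le> ip z x \<and> ip z x < a} else 1)"
  have w: "w a > 0" "w b > 0"
    using prob_band_pos[OF z] \<tau> a b by (auto simp: w_def)
  \<comment> \<open>Two approximation errors and two tails cost \<open>6 * \<kappa>\<close>, at most
    \<open>e / 2\<close>; the other half of \<open>e\<close> pays for the two bands. The division by
    6 ensures \<open>5 * \<kappa> < w a\<close> and \<open>5 * \<kappa> < w b\<close>.\<close>
  define \<kappa> where "\<kappa> = min (e / 12) (min (w a / 6) (w b / 6))"
  have \<kappa>: "\<kappa> > 0" "\<kappa> \<le> e / 12" using e w by (auto simp: \<kappa>_def)
  have "\<kappa> \<le> w a / 6" "\<kappa> \<le> w b / 6" by (auto simp: \<kappa>_def)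
  then have \<kappa>w: "5 * \<kappa> < w a" "5 * \<kappa> < w b" using w by linarith+
  have approx: "\<exists>f \<rho>. unit_fun f \<and> \<rho> > 0 \<and> cont_scale \<rho> f \<and> (\<integral>x. \<bar>f x - indicator B x\<bar> \<partial>N) \<le> \<kappa> \<and>
      (\<integral>x. f x \<partial>N) \<le> prob B + \<kappa> \<and> (\<integral>x. f x * (1 - f x) \<partial>N) \<le> \<kappa>" if B: "B \<in> sets N" for B
  proof -
    obtain f where f: "unit_fun f" "sphere_ucont f" "(\<integral>x. \<bar>f x - indicator B x\<bar> \<partial>N) \<le> \<kappa>"
      by (rule approximableE[OF sets_approximable[OF B] \<kappa>(1)])
    have "(0 :: real) < 1 / 16 \<longrightarrow> (\<exists>\<rho>>0. cont_scale \<rho> f)"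
      using f(2) unfolding sphere_ucont_def cont_scale_def by (rule spec)
    then obtain \<rho> where "\<rho> > 0" "cont_scale \<rho> f" by auto
    have iB: "integrable N (\<lambda>x. \<bar>f x - indicator B x\<bar>)"
      by (rule integrable_diff_indicator[OF f(1) B])
    have "(\<integral>x. f x \<partial>N) \<le> (\<integral>x. indicator B x + \<bar>f x - indicator B x\<bar> \<partial>N)"
      using integrable_unit[OF f(1)] integrable_unit[OF unit_fun_indicator[OF B]] iB
      by (intro integral_mono Bochner_Integration.integrable_add) auto
    also have "\<dots> \<le> prob B + \<kappa>"
      using f(3) iB B by (subst Bochner_Integration.integral_add) (auto simp: emeasure_eq_measure)
    finally have 1: "(\<integral>x. f x \<partial>N) \<le> prob B + \<kappa>" .
    \<comment> \<open>The product is at most either factor, and one of the factors is the distance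
      of \<open>f x\<close> to the indicator.\<close>
    have "(\<integral>x. f x * (1 - f x) \<partial>N) \<le> (\<integral>x. \<bar>f x - indicator B x\<bar> \<partial>N)"
    proof (rule integral_mono[OF _ iB])
      show "integrable N (\<lambda>x. f x * (1 - f x))"
        using f by (intro integrable_const_bound[of _ 1])
            (auto simp: unit_fun_def space_N abs_mult mult_le_one)
      fix x assume "x \<in> space N"
      then have "0 \<le> f x" "f x \<le> 1" using f by (auto simp: unit_fun_def space_N)
      then show "f x * (1 - f x) \<le> \<bar>f x - indicator B x\<bar>"
        using mult_left_le_one_le[of "1 - f x" "f x"] mult_right_le_one_le[of "f x" "1 - f x"]
        by (auto simp: indicator_def mult.commute)
    qed
    then show ?thesis using f 1 \<open>\<rho> > 0\<close> \<open>cont_scale \<rho> f\<close> by (intro exI[of _ f] exI[of _ \<rho>]) auto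
  qed
  obtain f r where f: "unit_fun f" "r > 0" "cont_scale r f" "(\<integral>x. \<bar>f x - indicator A x\<bar> \<partial>N) \<le> \<kappa>"
    "(\<integral>x. f x \<partial>N) \<le> prob A + \<kappa>" "(\<integral>x. f x * (1 - f x) \<partial>N) \<le> \<kappa>"
    using approx[OF A] by blast
  obtain h s where h: "unit_fun h" "s > 0" "cont_scale s h" "(\<integral>x. \<bar>h x - indicator C x\<bar> \<partial>N) \<le> \<kappa>"
    "(\<integral>x. h x \<partial>N) \<le> prob C + \<kappa>" "(\<integral>x. h x * (1 - h x) \<partial>N) \<le> \<kappa>"
    using approx[OF C] by blast
  \<comment> \<open>A common scale is needed because both functions undergo the same
    reflections.\<close>
  have sc: "cont_scale (min r s) f" "cont_scale (min r s) h" "min r s > 0"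
    using f h by (auto simp: cont_scale_def)
  obtain f' h' where g: "unit_fun f'" "unit_fun h'" "rearr f' f" "rearr h' h"
    "energy c f h \<le> energy c f' h'" "almost_mono z \<tau> f'" "almost_mono z \<tau> h'"
    by (rule ex_almost_mono[OF f(1) sc(1) h(1) sc(2) z \<tau>(1) sc(3)])
  define Xa where "Xa = {x \<in> S. a \<le> ip z x}"
  define Xb where "Xb = {x \<in> S. b \<le> ip z x}"
  define Ta where "Ta = {x \<in> S. ip z x < a - 2 * \<tau>}"
  define Tb where "Tb = {x \<in> S. ip z x < b - 2 * \<tau>}"
  define Ba where "Ba = {x \<in> S. a - 2 * \<tau> \<le> ip z x \<and> ip z x < a}"
  define Bb where "Bb = {x \<in> S. b - 2 * \<tau> \<le> ip z x \<and> ip z x < b}"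
  have ms[measurable]: "Xa \<in> sets N" "Xb \<in> sets N" "Ta \<in> sets N" "Tb \<in> sets N" "Ba \<in> sets N" "Bb \<in>
      sets N"
    unfolding Xa_def Xb_def Ta_def Tb_def Ba_def Bb_def by (auto intro!: sm)
  have mult_diff: "p * q \<le> p' * q' + \<bar>p' - p\<bar> + \<bar>q' - q\<bar>"
    if "0 \<le> p" "p \<le> 1" "0 \<le> q'" "q' \<le> 1" for p q p' q' :: real
  proof -
    have "p * q - p' * q' = p * (q - q') + (p - p') * q'" by algebra
    also have "\<dots> \<le> \<bar>p * (q - q')\<bar> + \<bar>(p - p') * q'\<bar>" by linarith
    also have "\<dots> \<le> 1 * \<bar>q - q'\<bar> + \<bar>p - p'\<bar> * 1"
      using that unfolding abs_mult by (intro add_mono mult_mono) auto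
    finally show ?thesis by (simp add: abs_minus_commute)
  qed
  have 1: "energy c (indicator A)
      (indicator C) \<le> energy c f h + (\<integral>x. \<bar>f x - indicator A x\<bar> \<partial>N)
      + (\<integral>x. \<bar>h x - indicator C x\<bar> \<partial>N)"
  proof (rule energy_le_add)
    show "unit_fun (\<lambda>x. \<bar>f x - indicator A x\<bar>)" "unit_fun (\<lambda>x. \<bar>h x - indicator C x\<bar>)"
      using f(1) h(1) A C by (auto simp: unit_fun_def indicator_def)
    show "indicator A x * indicator C y \<le> f x * h y + \<bar>f x - indicator A x\<bar> + \<bar>h y - indicator C y\<bar>"
      if "x \<in> S" "y \<in> S" for x y
      using h(1) that by (intro mult_diff) (auto simp: unit_fun_def)
  qed (use f h A C in \<open>auto intro: unit_fun_indicator\<close>)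
  have 2: "energy c f' h' \<le> energy c (indicator (Xa \<union> Ba)) (indicator (Xb \<union> Bb)) +
      (\<integral>x. f' x * indicator Ta x \<partial>N) + (\<integral>x. h' x * indicator Tb x \<partial>N)"
  proof (rule energy_le_add)
    show "unit_fun (\<lambda>x. f' x * indicator Ta x)" "unit_fun (\<lambda>x. h' x * indicator Tb x)"
      using g(1,2) ms by (auto simp: unit_fun_def indicator_def)
    fix x y assume xy: "x \<in> S" "y \<in> S"
    then have u: "0 \<le> f' x" "f' x \<le> 1" "0 \<le> h' y" "h' y \<le> 1" using g by (auto simp: unit_fun_def)
    have "f' x * h' y \<le> 1" "f' x * h' y \<le> f' x" "f' x * h' y \<le> h' y"
      using u by (auto simp: mult_le_one mult_left_le mult_left_le_one_le)
    moreover have "x \<in> Xa \<union> Ba \<longleftrightarrow> x \<notin> Ta" "y \<in> Xb \<union> Bb \<longleftrightarrow> y \<notin> Tb"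
      using xy \<tau> by (auto simp: Xa_def Ba_def Ta_def Xb_def Bb_def Tb_def)
    ultimately show "f' x * h' y
        \<le> indicator (Xa \<union> Ba) x * indicator (Xb \<union> Bb) y + f' x * indicator Ta x
        + h' y * indicator Tb y"
      using u by (auto simp: indicator_def)
  qed (use g ms in \<open>auto intro!: unit_fun_indicator\<close>)
  have 3: "(\<integral>x. f' x * indicator Ta x \<partial>N) \<le> 2 * \<kappa>"
    unfolding Ta_def using g(3) f(5,6) a \<kappa>w(1)
    by (intro almost_mono_tail[OF g(1,6) z \<tau>(1)]) (auto simp: rearr_def w_def)
  have 4: "(\<integral>x. h' x * indicator Tb x \<partial>N) \<le> 2 * \<kappa>"
    unfolding Tb_def using g(4) h(5,6) b \<kappa>w(2)
    by (intro almost_mono_tail[OF g(2,7) z \<tau>(1)]) (auto simp: rearr_def w_def)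
  have 5: "energy c (indicator (Xa \<union> Ba)) (indicator (Xb \<union> Bb))
      \<le> energy c (indicator Xa) (indicator Xb) + (\<integral>x. indicator Ba x \<partial>N) + (\<integral>x. indicator Bb x \<partial>N)"
    using ms by (intro energy_le_add unit_fun_indicator) (auto simp: indicator_def)
  have 6: "(\<integral>x. indicator Ba x \<partial>N) \<le> e / 4"
    using t1(2)[OF \<tau>(1,2), folded Ba_def] by (simp only: integral_indicator_eq[OF ms(5)])
  have 7: "(\<integral>x. indicator Bb x \<partial>N) \<le> e / 4"
    using t2(2)[OF \<tau>(1,3), folded Bb_def] by (simp only: integral_indicator_eq[OF ms(6)])
  show "energy c (indicator A) (indicator C)
    \<le> energy c (indicator {x \<in> S. a \<le> ip z x}) (indicator {x \<in> S. b \<le> ip z x}) + e"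
    using 1 2 3 4 5 6 7 f(4) h(4) g(5) \<kappa>(2) unfolding Xa_def[symmetric] Xb_def[symmetric]
      by linarith
qed

section \<open>Intersections with random caps\<close>

abbreviation cap_set :: "(nat \<Rightarrow> real) \<Rightarrow> real \<Rightarrow> (nat \<Rightarrow> real) set" where
  "cap_set y c \<equiv> {x \<in> S. c \<le> ip y x}"

lemma cap_set_sets [measurable]: "cap_set y c \<in> sets N"
  unfolding space_N[symmetric] by measurable

text \<open>Cauchy-Schwarz for the components of \<open>x\<close> and \<open>w\<close> orthogonal to
  \<open>y\<close> bounds \<open>ip x w\<close> below by the cosine of the sum of the two angles. A
  sum beyond \<open>pi\<close> needs no estimate.\<close>

lemma arccos_ip_triangle:
  assumes "x \<in> S" "y \<in> S" "w \<in> S"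
  shows "arccos (ip x w) \<le> arccos (ip x y) + arccos (ip y w)"
proof (cases "arccos (ip x y) + arccos (ip y w) \<le> pi")
  case True
  define a b where "a = ip x y" and "b = ip y w"
  have ab: "-1 \<le> a" "a \<le> 1" "-1 \<le> b" "b \<le> 1"
    using abs_ip_le[OF assms(1,2)] abs_ip_le[OF assms(2,3)] by (auto simp: a_def b_def)
  have "(ip x w - a * b)\<^sup>2 \<le> (1 - a\<^sup>2) * (1 - b\<^sup>2)"
  proof -
    have "ip (lincomb 1 x (- a) y) (lincomb 1 w (- b) y) = ip x w - a * b"
      using assms by (simp add: ip_lincomb ip_sphere a_def[symmetric] b_def[symmetric])
    moreover have "ip (lincomb 1 x (- a) y) (lincomb 1 x (- a) y) = 1 - a\<^sup>2"
      using assms by (simp add: ip_lincomb ip_sphere ip_commute[of y x] a_def[symmetric]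
          power2_eq_square)
    moreover have "ip (lincomb 1 w (- b) y) (lincomb 1 w (- b) y) = 1 - b\<^sup>2"
      using assms by (simp add: ip_lincomb ip_sphere ip_commute[of w y] b_def[symmetric]
          power2_eq_square)
    ultimately show ?thesis
      using Cauchy_Schwarz_ip[of "lincomb 1 x (- a) y" "lincomb 1 w (- b) y"] by simp
  qed
  then have "\<bar>ip x w - a * b\<bar> \<le> sqrt ((1 - a\<^sup>2) * (1 - b\<^sup>2))"
    using real_le_rsqrt by fastforce
  then have "a * b - sqrt (1 - a\<^sup>2) * sqrt (1 - b\<^sup>2) \<le> ip x w"
    by (simp add: real_sqrt_mult)
  moreover have "cos (arccos a + arccos b) = a * b - sqrt (1 - a\<^sup>2) * sqrt (1 - b\<^sup>2)"
    using ab by (simp add: cos_add sin_arccos)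
  ultimately have "arccos (ip x w) \<le> arccos (cos (arccos a + arccos b))"
    using abs_ip_le[OF assms(1,3)] cos_ge_minus_one[of "arccos a + arccos b"]
    by (intro arccos_le_arccos) auto
  also have "\<dots> = arccos a + arccos b"
    using True ab by (intro arccos_cos)
        (auto simp: a_def b_def arccos_lbound intro!: add_nonneg_nonneg)
  finally show ?thesis by (simp add: a_def b_def)
next
  case False
  then show ?thesis
    using arccos_ubound[of "ip x w"] abs_ip_le[OF assms(1,3)] by linarith
qed

text \<open>Truncation at \<open>pi\<close> keeps the angle where cosine is decreasing; beyond it
  the cap is the whole sphere, of threshold -1.\<close>

lemma arccos_le_iff:
  assumes "y \<in> S" "x \<in> S" "0 \<le> \<theta>"
  shows "arccos (ip y x) \<le> \<theta> \<longleftrightarrow> cos (min pi \<theta>) \<le> ip y x"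
proof -
  have b: "-1 \<le> ip y x" "ip y x \<le> 1" using abs_ip_le[OF assms(1,2)] by auto
  have "arccos (ip y x) \<le> \<theta> \<longleftrightarrow> arccos (ip y x) \<le> min pi \<theta>"
    using arccos_ubound[OF b] by simp
  also have "\<dots> \<longleftrightarrow> cos (min pi \<theta>) \<le> cos (arccos (ip y x))"
    using assms(3) arccos_lbound[OF b] arccos_ubound[OF b] by (subst cos_mono_le_eq) auto
  finally show ?thesis using b by simp
qed

lemma prob_cap_inter:
  assumes "A \<in> sets N"
  shows "prob (A \<inter> cap_set y c) = (\<integral>x. indicator A x * kern c y x \<partial>N)"
proof -
  have "(\<integral>x. indicator A x * kern c y x \<partial>N) = (\<integral>x. indicator (A \<inter> cap_set y c) x \<partial>N)"
    by (intro Bochner_Integration.integral_cong) (auto simp: space_N kern_def indicator_def)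
  also have "\<dots> = prob (A \<inter> cap_set y c)"
    using assms by (intro integral_indicator_eq) auto
  finally show ?thesis by simp
qed

lemma prob_cap_inter_measurable [measurable]:
  assumes [measurable]: "A \<in> sets N"
  shows "(\<lambda>y. prob (A \<inter> cap_set y c)) \<in> borel_measurable N"
proof -
  have [measurable]: "(\<lambda>(y, x). indicat_real A x * kern c y x) \<in> borel_measurable (N \<Otimes>\<^sub>M N)"
    by (simp add: case_prod_unfold)
  show ?thesis unfolding prob_cap_inter[OF assms] by measurable
qed

lemma kern_commute: "kern c x y = kern c y x"
  by (simp add: kern_def ip_commute)

text \<open>Fubini in both orders.\<close>

lemma energy_indicator:
  assumes A[measurable]: "A \<in> sets N" and B[measurable]: "B \<in> sets N"
  shows "energy c (indicator A) (indicator B) = (\<integral>y. indicator B y * prob (A \<inter> cap_set y c) \<partial>N)"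
    "energy c (indicator A) (indicator B) = (\<integral>x. indicator A x * prob (B \<inter> cap_set x c) \<partial>N)"
proof -
  have i: "integrable (N \<Otimes>\<^sub>M N) (\<lambda>(x, y). indicator A x * indicator B y * kern c x y)"
    using energy_integrable[OF unit_fun_indicator[OF A] unit_fun_indicator[OF B], of c]
    by (simp add: case_prod_unfold)
  have e: "energy c (indicator A)
      (indicator B) = (\<integral>(x, y). indicator A x * indicator B y * kern c x y \<partial>(N \<Otimes>\<^sub>M N))"
    by (simp add: energy_def case_prod_unfold)
  show "energy c (indicator A) (indicator B) = (\<integral>x. indicator A x * prob (B \<inter> cap_set x c) \<partial>N)"
    unfolding e P.integral_fst[OF i, symmetric] prob_cap_inter[OF B]
    by (simp add: mult.assoc)
  have "(\<integral>x. indicator A x * indicator B y * kern c x y \<partial>N)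
      = indicator B y * prob (A \<inter> cap_set y c)" for y
  proof -
    have "(\<integral>x. indicator A x * indicator B y * kern c x y \<partial>N)
        = (\<integral>x. indicator B y * (indicator A x * kern c y x) \<partial>N)"
      by (simp add: mult_ac kern_commute)
    then show ?thesis by (simp add: prob_cap_inter[OF A])
  qed
  then show "energy c (indicator A) (indicator B) = (\<integral>y. indicator B y * prob (A \<inter> cap_set y c) \<partial>N)"
    unfolding e P.integral_snd[OF i, symmetric] by simp
qed

text \<open>All caps with the same threshold have the same probability, so the total depends on
  \<open>A\<close> only through \<open>prob A\<close>. This is what reverses the inequality on
  complements.\<close>

lemma energy_split:
  assumes A: "A \<in> sets N" and B: "B \<in> sets N" and z: "z \<in> S"
  shows "energy c (indicator A) (indicator B) + energy c (indicator A)
      (indicator (S - B)) = prob A * prob (cap_set z c)"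
proof -
  have SB: "S - B \<in> sets N" using B by (simp add: space_N[symmetric])
  have i: "integrable N (\<lambda>x. indicator A x * prob (D \<inter> cap_set x c))" if "D \<in> sets N" for D
    using A that by (intro integrable_const_bound[of _ 1]) (auto simp: indicator_def)
  have "energy c (indicator A) (indicator B) + energy c (indicator A) (indicator (S - B))
      = (\<integral>x. indicator A x * prob (B \<inter> cap_set x c) + indicator A x * prob ((S - B)
          \<inter> cap_set x c) \<partial>N)"
    unfolding energy_indicator(2)[OF A B] energy_indicator(2)[OF A SB]
    using i[OF B] i[OF SB] by simp
  also have "\<dots> = (\<integral>x. indicator A x * prob (cap_set z c) \<partial>N)"
  proof (intro Bochner_Integration.integral_cong refl)
    fix x assume "x \<in> space N"
    then have x: "x \<in> S" by (simp add: space_N)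
    have "prob (B \<inter> cap_set x c) + prob ((S - B) \<inter> cap_set x c)
        = prob ((B \<inter> cap_set x c) \<union> ((S - B) \<inter> cap_set x c))"
      using B SB by (intro finite_measure_Union[symmetric]) auto
    also have "(B \<inter> cap_set x c) \<union> ((S - B) \<inter> cap_set x c) = cap_set x c" by auto
    also have "prob (cap_set x c) = prob (cap_set z c)"
      using prob_ip_eq[OF x z, of "{c..}"] by simp
    finally show "indicator A x * prob (B \<inter> cap_set x c) + indicator A x * prob ((S - B)
        \<inter> cap_set x c)
        = indicator A x * prob (cap_set z c)"
      by (simp flip: distrib_left)
  qed
  also have "\<dots> = prob A * prob (cap_set z c)" using integral_indicator_eq[OF A] by simp
  finally show ?thesis .
qed

lemma reverse_riesz:
  assumes A: "A \<in> sets N" and B: "B \<in> sets N" and z: "z \<in> S"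
    and a: "a \<le> 1" "prob A = prob (cap_set z a)"
  obtains L where "L \<in> sets N" "prob L = prob B"
    "energy c (indicator (cap_set z a)) (indicator L) \<le> energy c (indicator A) (indicator B)"
proof -
  have SB: "S - B \<in> sets N" using B by (simp add: space_N[symmetric])
  obtain b where b: "b \<le> 1" "prob (cap_set z b) = prob (S - B)"
    using ex_cap_prob[OF z, of "prob (S - B)"] by auto
  have SS: "S - (S - B) = B" using sets.sets_into_space[OF B] by (auto simp: space_N)
  define L where "L = S - cap_set z b"
  have L: "L \<in> sets N" by (simp add: L_def space_N[symmetric])
  have "prob L = 1 - prob (cap_set z b)"
    using prob_compl[of "cap_set z b"] by (simp add: L_def space_N)
  also have "\<dots> = prob B"
    using prob_compl[OF SB] by (simp add: b space_N SS)
  finally have pL: "prob L = prob B" .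
  have "energy c (indicator A) (indicator (S - B))
      \<le> energy c (indicator (cap_set z a)) (indicator (cap_set z b))"
    by (rule riesz_rearrangement[OF A SB z a b(1) b(2)[symmetric]])
  moreover have "energy c (indicator A) (indicator (S - B)) + energy c (indicator A) (indicator B)
      = prob A * prob (cap_set z c)"
    using energy_split[OF A SB z, of c] by (simp add: SS)
  moreover have "energy c (indicator (cap_set z a)) (indicator (cap_set z b)) +
      energy c (indicator (cap_set z a)) (indicator L) = prob A * prob (cap_set z c)"
    using energy_split[OF cap_set_sets[of a z] cap_set_sets[of b z] z, of c] by (simp add: L_def a)
  ultimately have "energy c (indicator (cap_set z a)) (indicator L) \<le> energy c (indicator A)
      (indicator B)"
    by linarith
  then show ?thesis using that L pL by blast
qed

text \<open>The point \<open>e\<close> of the equator nearest to \<open>y\<close> is within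
  \<open>\<epsilon>\<close> of \<open>y\<close>, so the cap around \<open>y\<close> contains the one
  around \<open>e\<close>. The latter meets the cap of \<open>z\<close> as the cap around
  \<open>y0\<close> does.\<close>

lemma cap_inter_ge:
  assumes z: "z \<in> S" and y0: "y0 \<in> S" "ip z y0 = 0" and y: "y \<in> S" "\<bar>ip z y\<bar> < sin \<epsilon>"
    and \<epsilon>: "0 < \<epsilon>" "\<epsilon> \<le> pi" and \<omega>: "0 \<le> \<omega>" "\<omega> \<le> pi"
  shows "prob (cap_set z a \<inter> cap_set y0 (cos \<omega>))
      \<le> prob (cap_set z a \<inter> cap_set y (cos (min pi (\<omega> + \<epsilon>))))"
proof -
  have lt1: "\<bar>ip z y\<bar> < 1" using y(2) sin_le_one[of \<epsilon>] by linarith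
  obtain e where e: "e \<in> S" "ip z e = 0" "ip y e = sqrt (1 - (ip z y)\<^sup>2)"
    by (rule orthogonal_decomposition[OF z y(1) lt1])
  have "(ip z y)\<^sup>2 \<le> (sin \<epsilon>)\<^sup>2" using y(2) abs_le_square_iff[of "ip z y" "sin \<epsilon>"] by simp
  then have "(cos \<epsilon>)\<^sup>2 \<le> 1 - (ip z y)\<^sup>2" using sin_cos_squared_add[of \<epsilon>] by linarith
  then have "cos \<epsilon> \<le> ip y e" unfolding e(3) by (rule real_le_rsqrt)
  then have ye: "arccos (ip y e) \<le> \<epsilon>"
    using \<epsilon> by (subst arccos_le_iff[OF y(1) e(1)]) auto
  have "cap_set e (cos \<omega>) \<subseteq> cap_set y (cos (min pi (\<omega> + \<epsilon>)))"
  proof safe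
    fix x assume x: "x \<in> S" "cos \<omega> \<le> ip e x"
    then have "arccos (ip e x) \<le> \<omega>" using \<omega> by (subst arccos_le_iff[OF e(1) x(1)]) auto
    then have "arccos (ip y x) \<le> \<omega> + \<epsilon>" using arccos_ip_triangle[OF y(1) e(1) x(1)] ye by linarith
    then show "cos (min pi (\<omega> + \<epsilon>)) \<le> ip y x"
      using arccos_le_iff[OF y(1) x(1), of "\<omega> + \<epsilon>"] \<omega> \<epsilon> by auto
  qed
  then have "prob (cap_set z a \<inter> cap_set e (cos \<omega>))
      \<le> prob (cap_set z a \<inter> cap_set y (cos (min pi (\<omega> + \<epsilon>))))"
    by (intro finite_measure_mono) auto
  moreover have "prob (cap_set z a \<inter> cap_set y0 (cos \<omega>)) = prob (cap_set z a \<inter> cap_set e (cos \<omega>))"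
  proof -
    \<comment> \<open>The axis is orthogonal to \<open>z\<close>, so the reflection exchanging
      \<open>y0\<close> and \<open>e\<close> preserves the cap around \<open>z\<close>.\<close>
    define u where "u = lincomb 1 y0 (- 1) e"
    have uz: "ip u z = 0" using y0 e by (simp add: u_def ip_lincomb ip_commute[of _ z])
    have "reflect u y0 = e" unfolding u_def by (rule reflect_swap[OF y0(1) e(1)])
    then have r: "ip z (reflect u x) = ip z x" "ip y0 (reflect u x) = ip e x" for x
      using ip_reflect_left[of u y0 x] uz by (auto simp: ip_reflect)
    have "cap_set z a \<inter> cap_set y0 (cos \<omega>) \<in> sets N" by auto
    from prob_reflect[OF this, of u]
    have "prob (cap_set z a \<inter> cap_set y0 (cos \<omega>))
        = prob {x \<in> S. reflect u x \<in> cap_set z a \<inter> cap_set y0 (cos \<omega>)}" by simp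
    also have "{x \<in> S. reflect u x \<in> cap_set z a \<inter> cap_set y0 (cos \<omega>)}
        = cap_set z a \<inter> cap_set e (cos \<omega>)"
      by (auto simp: r reflect_in_sphere)
    finally show ?thesis .
  qed
  ultimately show ?thesis by simp
qed

text \<open>The angle between \<open>z\<close> and \<open>y\<close> is less than the sum of the two
  radii, so some point \<open>w\<close> of the great circle through them is interior to both caps.
  Strict positivity settles the case of vanishing \<open>v\<close> below.\<close>

lemma cap_inter_pos:
  assumes z: "z \<in> S" and y: "y \<in> S" "\<bar>ip z y\<bar> < sin \<epsilon>"
    and \<epsilon>: "0 < \<epsilon>" "\<epsilon> < pi / 2" and \<theta>: "0 < \<theta>" "\<theta> \<le> pi" and \<omega>: "0 \<le> \<omega>" "pi / 2 < \<theta> + \<omega>"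
  shows "0 < prob (cap_set z (cos \<theta>) \<inter> cap_set y (cos (min pi (\<omega> + \<epsilon>))))"
proof -
  define W where "W = min pi (\<omega> + \<epsilon>)"
  define \<alpha> where "\<alpha> = arccos (ip z y)"
  have lt1: "\<bar>ip z y\<bar> < 1" using y(2) sin_le_one[of \<epsilon>] by linarith
  then have b: "-1 < ip z y" "ip z y < 1" by auto
  have \<alpha>: "0 < \<alpha>" "\<alpha> < pi" using arccos_lt_bounded[OF b] by (auto simp: \<alpha>_def)
  have "cos (pi / 2 + \<epsilon>) < ip z y" using y(2) by (simp add: cos_add)
  then have "\<alpha> < arccos (cos (pi / 2 + \<epsilon>))"
    unfolding \<alpha>_def using b cos_ge_minus_one[of "pi / 2 + \<epsilon>"] by (intro arccos_less_arccos) auto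
  then have "\<alpha> < pi / 2 + \<epsilon>" using \<epsilon> by (simp add: arccos_cos)
  then have \<alpha>2: "\<alpha> < \<theta> + W" using \<alpha> \<theta> \<omega> by (auto simp: W_def min_def)
  have W: "0 < W" "W \<le> pi" using \<omega> \<epsilon> by (auto simp: W_def)
  \<comment> \<open>The angle \<open>\<alpha>\<close> is divided in the ratio of the radii
    \<open>\<theta>\<close> and \<open>W\<close>.\<close>
  define \<beta> where "\<beta> = \<alpha> * \<theta> / (\<theta> + W)"
  have \<beta>: "0 < \<beta>" "\<beta> < \<theta>"
    using \<alpha> \<theta> W mult_strict_right_mono[OF \<alpha>2 \<theta>(1)]
    by (auto simp: \<beta>_def pos_divide_less_eq mult.commute)
  have "\<alpha> - \<beta> = \<alpha> * W / (\<theta> + W)" using \<theta> W by (simp add: \<beta>_def field_simps)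
  then have \<alpha>\<beta>: "0 < \<alpha> - \<beta>" "\<alpha> - \<beta> < W"
    using \<alpha> \<theta> W mult_strict_right_mono[OF \<alpha>2 W(1)]
    by (auto simp: pos_divide_less_eq mult.commute)
  obtain e where e: "e \<in> S" "ip z e = 0"
    "\<And>x. ip y x = ip z y * ip z x + sqrt (1 - (ip z y)\<^sup>2) * ip e x"
    using orthogonal_decomposition[OF z y(1) lt1] by blast
  define w where "w = lincomb (cos \<beta>) z (sin \<beta>) e"
  have w: "w \<in> S" unfolding w_def by (rule great_circle_in_sphere[OF z e(1,2)])
  have zw: "ip z w = cos \<beta>" using z e by (simp add: w_def ip_lincomb ip_sphere)
  have ew: "ip e w = sin \<beta>" using z e by (simp add: w_def ip_lincomb ip_sphere ip_commute[of e z])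
  have "ip y w = cos \<alpha> * cos \<beta> + sin \<alpha> * sin \<beta>"
    unfolding e(3)[of w] zw ew \<alpha>_def using b by (simp add: sin_arccos)
  then have yw: "ip y w = cos (\<alpha> - \<beta>)" by (simp add: cos_diff)
  \<comment> \<open>The smaller of the two margins by which \<open>w\<close> is interior.\<close>
  define d where "d = min (cos \<beta> - cos \<theta>) (cos (\<alpha> - \<beta>) - cos W)"
  have "cos \<theta> < cos \<beta>" using \<beta> \<theta> by (intro cos_monotone_0_pi) auto
  moreover have "cos W < cos (\<alpha> - \<beta>)" using \<alpha>\<beta> W by (intro cos_monotone_0_pi) auto
  ultimately have d: "0 < d" by (simp add: d_def)
  have "cap_set w (1 - d\<^sup>2 / 2) \<subseteq> cap_set z (cos \<theta>) \<inter> cap_set y (cos W)"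
  proof safe
    fix x assume x: "x \<in> S" "1 - d\<^sup>2 / 2 \<le> ip w x"
    have "\<bar>ip z x - cos \<beta>\<bar> \<le> d" "\<bar>ip y x - cos (\<alpha> - \<beta>)\<bar> \<le> d"
      using ip_close[OF z w x(1) _ x(2)] ip_close[OF y(1) w x(1) _ x(2)] d zw yw by auto
    moreover have "d \<le> cos \<beta> - cos \<theta>" "d \<le> cos (\<alpha> - \<beta>) - cos W" by (auto simp: d_def)
    ultimately show "cos \<theta> \<le> ip z x" "cos W \<le> ip y x" by linarith+
  qed
  then have "prob (cap_set w (1 - d\<^sup>2 / 2)) \<le> prob (cap_set z (cos \<theta>) \<inter> cap_set y (cos W))"
    by (intro finite_measure_mono) auto
  moreover have "0 < prob (cap_set w (1 - d\<^sup>2 / 2))" using w d by (intro prob_cap_pos) auto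
  ultimately show ?thesis by (simp add: W_def)
qed

lemma prob_large_intersection:
  assumes A: "A \<in> sets N" and z: "z \<in> S" and y0: "y0 \<in> S" "ip z y0 = 0"
    and \<theta>: "0 < \<theta>" "\<theta> \<le> pi" "prob A = prob (cap_set z (cos \<theta>))"
    and \<omega>: "0 \<le> \<omega>" "\<omega> \<le> pi" "pi / 2 < \<theta> + \<omega>"
    and \<epsilon>: "0 < \<epsilon>" "\<epsilon> < 1" and m_large: "1 / (\<epsilon>\<^sup>2 * (sin \<epsilon>)\<^sup>2) < m"
  defines "v \<equiv> prob (cap_set z (cos \<theta>) \<inter> cap_set y0 (cos \<omega>))"
  shows "1 - \<epsilon> \<le> prob {y \<in> S. (1 - \<epsilon>) * v < prob (A \<inter> cap_set y (cos (min pi (\<omega> + \<epsilon>))))}"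
proof (rule ccontr)
  define c where "c = cos (min pi (\<omega> + \<epsilon>))"
  define G where "G = {y \<in> S. (1 - \<epsilon>) * v < prob (A \<inter> cap_set y c)}"
  assume "\<not> ?thesis"
  then have G: "prob G < 1 - \<epsilon>" by (simp add: G_def c_def)
  have Gm: "G \<in> sets N" 
    using borel_measurable_less[OF borel_measurable_const prob_cap_inter_measurable[OF A]]
    unfolding G_def by (simp only: space_N)
  define B where "B = S - G"
  have B: "B \<in> sets N" using Gm by (simp add: B_def space_N[symmetric])
  have pB: "prob B > \<epsilon>" using prob_compl[OF Gm] G by (simp add: B_def space_N)
  have \<epsilon>2: "\<epsilon> < pi / 2" "\<epsilon> \<le> pi" using \<epsilon> pi_gt3 by auto
  have s: "0 < sin \<epsilon>" using \<epsilon> \<epsilon>2 by (intro sin_gt_zero) auto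
  obtain L where L: "L \<in> sets N" "prob L = prob B"
    "energy c (indicator (cap_set z (cos \<theta>))) (indicator L) \<le> energy c (indicator A) (indicator B)"
    by (rule reverse_riesz[OF A B z cos_le_one \<theta>(3)])
  define \<psi> where "\<psi> = (\<lambda>y. prob (cap_set z (cos \<theta>) \<inter> cap_set y c))"
  have [measurable]: "\<psi> \<in> borel_measurable N" unfolding \<psi>_def by measurable
  define F where "F = {y \<in> S. sin \<epsilon> \<le> \<bar>ip z y\<bar>}"
  have F: "F \<in> sets N" unfolding F_def space_N[symmetric] by measurable
  define \<delta> where "\<delta> = 1 / (m * (sin \<epsilon>)\<^sup>2)"
  have \<delta>: "\<delta> < \<epsilon>\<^sup>2" using m_large s \<epsilon> m_ge2 by (simp add: \<delta>_def field_simps)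
  have pF: "prob F \<le> \<delta>" unfolding F_def \<delta>_def by (rule prob_ip_ge_le[OF z s])
  \<comment> \<open>The part of \<open>L\<close> near the equator, where the intersection with the
    cap is at least \<open>v\<close>.\<close>
  define K where "K = L - F"
  have K[measurable]: "K \<in> sets N" using L F by (auto simp: K_def)
  have "prob L \<le> prob (K \<union> F)" using K F L by (intro finite_measure_mono) (auto simp: K_def)
  also have "\<dots> \<le> prob K + prob F" using K F by (intro measure_Un_le) auto
  finally have pK: "prob B - \<delta> \<le> prob K" using pF L by simp
  have Kmem: "y \<in> S" "\<bar>ip z y\<bar> < sin \<epsilon>" if "y \<in> K" for y
    using that sets.sets_into_space[OF L(1)] by (auto simp: K_def F_def space_N)
  have \<psi>v: "v \<le> \<psi> y" "0 < \<psi> y" if "y \<in> K" for y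
    unfolding v_def \<psi>_def c_def
    using cap_inter_ge[OF z y0 Kmem[OF that] \<epsilon>(1) \<epsilon>2(2) \<omega>(1,2)]
      cap_inter_pos[OF z Kmem[OF that] \<epsilon>(1) \<epsilon>2(1) \<theta>(1,2) \<omega>(1,3)] by auto
  have \<psi>i: "integrable N (\<lambda>y. indicator D y * \<psi> y)" if "D \<in> sets N" for D
    using that by (intro integrable_const_bound[of _ 1]) (auto simp: \<psi>_def indicator_def)
  \<comment> \<open>The reversed Riesz inequality links the lower bound on \<open>K\<close> with the
    upper bound on the bad set \<open>B\<close>.\<close>
  have "(\<integral>y. indicator K y * \<psi> y \<partial>N) \<le> (\<integral>y. indicator L y * \<psi> y \<partial>N)"
    using L K by (intro integral_mono \<psi>i) (auto simp: K_def indicator_def \<psi>_def)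
  also have "\<dots> = energy c (indicator (cap_set z (cos \<theta>))) (indicator L)"
    using energy_indicator(1)[OF cap_set_sets L(1)] by (simp add: \<psi>_def)
  also have "\<dots> \<le> energy c (indicator A) (indicator B)" by (rule L(3))
  also have "\<dots> = (\<integral>y. indicator B y * prob (A \<inter> cap_set y c) \<partial>N)"
    by (rule energy_indicator(1)[OF A B])
  also have "\<dots> \<le> (\<integral>y. indicator B y * ((1 - \<epsilon>) * v) \<partial>N)"
  proof (intro integral_mono)
    show "integrable N (\<lambda>y. indicator B y * prob (A \<inter> cap_set y c))"
      using A B by (intro integrable_const_bound[of _ 1]) (auto simp: indicator_def)
    show "integrable N (\<lambda>y. indicator B y * ((1 - \<epsilon>) * v))"
      using B by (simp add: emeasure_eq_measure)
    show "indicator B y * prob (A \<inter> cap_set y c) \<le> indicator B y * ((1 - \<epsilon>) * v)" for y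
      by (auto simp: indicator_def B_def G_def)
  qed
  also have "\<dots> = prob B * ((1 - \<epsilon>) * v)" using integral_indicator_eq[OF B] by simp
  finally have up: "(\<integral>y. indicator K y * \<psi> y \<partial>N) \<le> prob B * ((1 - \<epsilon>) * v)" .
  have v0: "0 \<le> v" by (simp add: v_def)
  show False
  proof (cases "v = 0")
    \<comment> \<open>This case occurs for \<open>\<omega> = 0\<close>.\<close>
    case True
    have "0 \<le> (\<integral>y. indicator K y * \<psi> y \<partial>N)"
      by (intro integral_nonneg_AE) (auto simp: \<psi>_def)
    then have "(\<integral>y. indicator K y * \<psi> y \<partial>N) = 0" using up True by simp
    then have "AE y in N. indicator K y * \<psi> y = 0"
      using \<psi>i[OF K] by (subst (asm) integral_nonneg_eq_0_iff_AE) (auto simp: \<psi>_def)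
    \<comment> \<open>Positivity of \<open>\<psi>\<close> on \<open>K\<close> makes \<open>K\<close>
      null, although its probability exceeds \<open>\<epsilon> - \<epsilon>\<^sup>2\<close>.\<close>
    then have "AE y in N. y \<notin> K"
      by eventually_elim (use \<psi>v(2) in \<open>force simp: indicator_def\<close>)
    then have "prob K = 0" using K by (simp add: prob_eq_0)
    moreover have "\<epsilon>\<^sup>2 < \<epsilon>" using \<epsilon> by (simp add: power2_eq_square)
    ultimately show False using pK pB \<delta> by linarith
  next
    case False
    have "prob K * v = (\<integral>y. indicator K y * v \<partial>N)" using integral_indicator_eq[OF K] by simp
    also have "\<dots> \<le> (\<integral>y. indicator K y * \<psi> y \<partial>N)"
      using K \<psi>v(1)
      by (intro integral_mono \<psi>i) (auto simp: emeasure_eq_measure, auto simp: indicator_def)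
    also note up
    finally have "prob K * v \<le> (prob B * (1 - \<epsilon>)) * v" by (simp add: mult.assoc)
    then have "prob K \<le> prob B * (1 - \<epsilon>)" using False v0 by simp
    then have "\<epsilon> * prob B \<le> \<delta>" using pK by (simp add: algebra_simps)
    moreover have "\<epsilon> * \<epsilon> < \<epsilon> * prob B" using pB \<epsilon> by simp
    ultimately show False using \<delta> by (simp add: power2_eq_square)
  qed
qed

end

section \<open>From the surface measure to the normalized one\<close>

lemma surface_measure_sphere_prob:
  assumes \<mu>: "is_surface_measure m R \<mu>" and R: "R > 0" and m: "m \<ge> 2"
  shows "sphere_prob (normalized_measure \<mu>) m R"
    "\<exists>K>0. \<forall>X\<in>sets \<mu>. measure \<mu> X = K * measure (normalized_measure \<mu>) X"
proof -
  define N where "N = normalized_measure \<mu>"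
  define K where "K = 2 * pi powr (real m / 2) / Gamma (real m / 2) * R ^ (m - 1)"
  have K: "K > 0"
    unfolding K_def using m R by (intro mult_pos_pos divide_pos_pos Gamma_real_pos) auto
  have sets_\<mu>: "sets \<mu> = sets (restrict_space (Pi\<^sub>M {..<m} (\<lambda>_. borel)) (euc_sphere m R))"
    using \<mu> by (simp add: is_surface_measure_def)
  have space_\<mu>: "space \<mu> = euc_sphere m R"
    using sets_eq_imp_space_eq[OF sets_\<mu>]
      by (auto simp: space_restrict_space space_PiM euc_sphere_def)
  have tot: "emeasure \<mu> (space \<mu>) = ennreal K"
    using \<mu> by (simp add: is_surface_measure_def space_\<mu> K_def)
  have em: "emeasure N X = emeasure \<mu> X / ennreal K" if "X \<in> sets \<mu>" for X
  proof -
    have "space \<mu> \<inter> X = X" using sets.sets_into_space[OF that] by auto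
    then show ?thesis
      using that by (simp add: N_def normalized_measure_def tot)
  qed
  have sets_N: "sets N = sets \<mu>" by (simp add: N_def normalized_measure_def)
  have "prob_space N"
    unfolding N_def normalized_measure_def using tot K
    by (intro prob_space_uniform_measure) (auto simp: ennreal_eq_0_iff)
  interpret prob_space N by fact
  have "distr N N (mat_apply m Q) = N" if Q: "orthogonal_mat m Q" for Q
  proof -
    have D: "distr \<mu> \<mu> (mat_apply m Q) = \<mu>"
      using \<mu> Q by (simp add: is_surface_measure_def)
    \<comment> \<open>Orthogonal matrices preserve the norm, hence map the sphere to itself; this is
      needed for measurability on the restricted space.\<close>
    have "L2_set (mat_apply m Q x) {..<m} = L2_set x {..<m}" for x
    proof -
      have "(\<Sum>i<m. (\<Sum>j<m. Q i j * x j)\<^sup>2) = (\<Sum>i<m. \<Sum>j<m. \<Sum>k<m. Q i j * Q i k * (x j * x k))"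
        by (simp add: power2_eq_square sum_product mult_ac)
      also have "\<dots> = (\<Sum>j<m. \<Sum>i<m. \<Sum>k<m. Q i j * Q i k * (x j * x k))" by (rule sum.swap)
      also have "\<dots> = (\<Sum>j<m. \<Sum>k<m. \<Sum>i<m. Q i j * Q i k * (x j * x k))"
        by (intro sum.cong refl sum.swap)
      also have "\<dots> = (\<Sum>j<m. \<Sum>k<m. (if j = k then 1 else 0) * (x j * x k))"
        using Q by (intro sum.cong refl) (simp add: orthogonal_mat_def flip: sum_distrib_right)
      also have "\<dots> = (\<Sum>j<m. (x j)\<^sup>2)"
        by (simp add: if_distrib[of "\<lambda>a. a * _"] power2_eq_square cong: if_cong)
      finally show ?thesis by (simp add: L2_set_def mat_apply_def)
    qed
    then have maps: "mat_apply m Q \<in> euc_sphere m R \<rightarrow> euc_sphere m R"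
      by (auto simp: euc_sphere_def) (auto simp: mat_apply_def)
    have comp: "(\<lambda>x. x j) \<in> borel_measurable \<mu>" if "j < m" for j
      using that by (subst measurable_cong_sets[OF sets_\<mu> refl])
        (auto intro!: measurable_restrict_space1 measurable_component_singleton)
    have "mat_apply m Q \<in> measurable \<mu> (restrict_space (Pi\<^sub>M {..<m} (\<lambda>_. borel)) (euc_sphere m R))"
    proof (rule measurable_restrict_space2)
      show "mat_apply m Q \<in> measurable \<mu> (Pi\<^sub>M {..<m} (\<lambda>_. borel))"
        unfolding mat_apply_def[abs_def] using comp by (intro measurable_restrict) auto
    qed (use maps in \<open>simp add: space_\<mu>\<close>)
    then have Qm: "mat_apply m Q \<in> measurable \<mu> \<mu>"
      by (subst measurable_cong_sets[OF refl sets_\<mu>])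
    have Qm': "mat_apply m Q \<in> measurable N N"
      using Qm by (simp add: measurable_cong_sets[OF sets_N sets_N])
    show ?thesis
    proof (rule measure_eqI)
      fix X assume "X \<in> sets (distr N N (mat_apply m Q))"
      then have X: "X \<in> sets \<mu>" by (simp add: sets_N)
      have sp: "space N = space \<mu>" by (rule sets_eq_imp_space_eq[OF sets_N])
      have "emeasure (distr N N (mat_apply m Q)) X = emeasure N (mat_apply m Q -` X \<inter> space \<mu>)"
        using X Qm' by (subst emeasure_distr) (auto simp: sets_N sp)
      also have "\<dots> = emeasure \<mu> (mat_apply m Q -` X \<inter> space \<mu>) / ennreal K"
        using Qm X by (intro em) auto
      also have "\<dots> = emeasure (distr \<mu> \<mu> (mat_apply m Q)) X / ennreal K"
        using X Qm by (subst emeasure_distr) auto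
      also have "\<dots> = emeasure N X" using X by (simp add: D em)
      finally show "emeasure (distr N N (mat_apply m Q)) X = emeasure N X" .
    qed simp
  qed
  then show "sphere_prob (normalized_measure \<mu>) m R"
    unfolding N_def[symmetric] using \<open>prob_space N\<close> R m sets_N sets_\<mu>
    by (simp add: sphere_prob_def sphere_prob_axioms_def)
  have "measure \<mu> X = K * measure N X" if "X \<in> sets \<mu>" for X
  proof -
    have "emeasure \<mu> X \<le> ennreal K"
      using emeasure_space[of \<mu> X] by (simp add: tot)
    then have fin: "emeasure \<mu> X = ennreal (measure \<mu> X)"
      by (metis emeasure_eq_ennreal_measure ennreal_less_top leD top.not_eq_extremum)
    have "ennreal (measure N X) = ennreal (measure \<mu> X / K)"
      using em[OF that] K by (simp add: emeasure_eq_measure fin divide_ennreal)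
    then have "measure N X = measure \<mu> X / K"
      using K by (simp add: ennreal_inj)
    then show ?thesis using K by simp
  qed
  then show "\<exists>K>0. \<forall>X\<in>sets \<mu>. measure \<mu> X = K * measure (normalized_measure \<mu>) X"
    using K N_def by blast
qed

theorem theorem1:
  fixes \<epsilon> :: real
  assumes "\<epsilon> > 0"
  shows "\<exists>M::nat. \<forall>m>M. \<forall>R>0. \<forall>\<mu>. is_surface_measure m R \<mu> \<longrightarrow>
    (\<forall>A \<theta> \<omega> z\<^sub>0 y\<^sub>0 V.
       A \<in> sets \<mu> \<longrightarrow>
       0 < \<theta> \<longrightarrow> \<theta> \<le> pi \<longrightarrow> has_effective_angle m R \<mu> A \<theta> \<longrightarrow>
       0 \<le> \<omega> \<longrightarrow> \<omega> \<le> pi \<longrightarrow> \<theta> + \<omega> > pi / 2 \<longrightarrow>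
       z\<^sub>0 \<in> euc_sphere m R \<longrightarrow> y\<^sub>0 \<in> euc_sphere m R \<longrightarrow> sph_angle m R z\<^sub>0 y\<^sub>0 = pi / 2 \<longrightarrow>
       V = measure \<mu> (sph_cap m R z\<^sub>0 \<theta> \<inter> sph_cap m R y\<^sub>0 \<omega>) \<longrightarrow>
       measure (normalized_measure \<mu>)
         {y \<in> euc_sphere m R. measure \<mu> (A \<inter> sph_cap m R y (\<omega> + \<epsilon>)) > (1 - \<epsilon>) * V}
         \<ge> 1 - \<epsilon>)"
proof (cases "\<epsilon> < 1")
  case False
  \<comment> \<open>Here \<open>1 - \<epsilon>\<close> is not positive, so any \<open>M\<close> will
    do.\<close>
  then show ?thesis
    by (intro exI allI impI) (rule order_trans[of _ 0], auto)
next
  case True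
  \<comment> \<open>The bound makes the Chebyshev estimate fall below
    \<open>\<epsilon>\<^sup>2\<close>.\<close>
  obtain M0 :: nat where M0: "1 / (\<epsilon>\<^sup>2 * (sin \<epsilon>)\<^sup>2) < M0" using reals_Archimedean2 by blast
  show ?thesis
  proof (rule exI[of _ "max 2 M0"], intro allI impI)
    fix m :: nat and R \<mu> A \<theta> \<omega> z0 y0 V
    assume m: "max 2 M0 < m" and R: "0 < R" and \<mu>: "is_surface_measure m R \<mu>"
      and A: "A \<in> sets \<mu>" and \<theta>: "0 < \<theta>" "\<theta> \<le> pi" "has_effective_angle m R \<mu> A \<theta>"
      and \<omega>: "0 \<le> \<omega>" "\<omega> \<le> pi" "pi / 2 < \<theta> + \<omega>"
      and z0: "z0 \<in> euc_sphere m R" and y0: "y0 \<in> euc_sphere m R" "sph_angle m R z0 y0 = pi / 2"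
      and V: "V = measure \<mu> (sph_cap m R z0 \<theta> \<inter> sph_cap m R y0 \<omega>)"
    have m2: "m \<ge> 2" using m by simp
    interpret sphere_prob "normalized_measure \<mu>" m R
      by (rule surface_measure_sphere_prob(1)[OF \<mu> R m2])
    obtain K where K: "K > 0" "\<And>X. X \<in> sets \<mu> \<Longrightarrow> measure \<mu> X = K * prob X"
      using surface_measure_sphere_prob(2)[OF \<mu> R m2] by blast
    have sets_eq: "sets \<mu> = events" by (simp add: normalized_measure_def)
    have angle: "sph_angle m R x y = arccos (ip x y)" for x y
      by (simp add: sph_angle_def ip_def)
    have cap: "sph_cap m R y t = cap_set y (cos (min pi t))" if "y \<in> S" "0 \<le> t" for y t
      using arccos_le_iff[OF that(1) _ that(2)] by (auto simp: sph_cap_def angle)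
    obtain z1 where z1: "z1 \<in> S" "measure \<mu> A = measure \<mu> (sph_cap m R z1 \<theta>)"
      using \<theta>(3) by (auto simp: has_effective_angle_def)
    \<comment> \<open>The pole witnessing the effective angle may differ from \<open>z0\<close>;
      invariance moves the cap.\<close>
    have "prob A = prob (cap_set z1 (cos \<theta>))"
      using z1 K \<theta> A by (simp add: cap sets_eq min_absorb2)
    also have "\<dots> = prob (cap_set z0 (cos \<theta>))"
      using prob_ip_eq[OF z1(1) z0, of "{cos \<theta>..}"] by simp
    finally have pA: "prob A = prob (cap_set z0 (cos \<theta>))" .
    have "ip z0 y0 = cos (arccos (ip z0 y0))" using abs_ip_le[OF z0 y0(1)] by (simp add: abs_le_iff)
    also have "\<dots> = 0" unfolding y0(2)[unfolded angle] by simp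
    finally have z0y0: "ip z0 y0 = 0" .
    have M: "1 / (\<epsilon>\<^sup>2 * (sin \<epsilon>)\<^sup>2) < m" using M0 m by linarith
    have V': "V = K * prob (cap_set z0 (cos \<theta>) \<inter> cap_set y0 (cos \<omega>))"
      using z0 y0 \<theta> \<omega> by (simp add: V cap sets_eq K(2) min_absorb2)
    \<comment> \<open>The positive factor \<open>K\<close> between the two measures cancels from
      both sides.\<close>
    have "{y \<in> S. (1 - \<epsilon>) * V < measure \<mu> (A \<inter> sph_cap m R y (\<omega> + \<epsilon>))} =
      {y \<in> S. (1 - \<epsilon>) * prob (cap_set z0 (cos \<theta>) \<inter> cap_set y0 (cos \<omega>))
        < prob (A \<inter> cap_set y (cos (min pi (\<omega> + \<epsilon>))))}"
    proof (rule Collect_cong, rule conj_cong[OF refl])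
      fix y assume y: "y \<in> S"
      have "measure \<mu> (A \<inter> sph_cap m R y (\<omega> + \<epsilon>)) = K * prob (A \<inter> cap_set y (cos (min pi (\<omega> + \<epsilon>))))"
        using A y assms \<omega> by (simp add: cap K(2) sets_eq)
      moreover have "(1 - \<epsilon>) * V = K * ((1 - \<epsilon>) * prob (cap_set z0 (cos \<theta>) \<inter> cap_set y0 (cos \<omega>)))"
        by (simp add: V')
      ultimately show "(1 - \<epsilon>) * V < measure \<mu> (A \<inter> sph_cap m R y (\<omega> + \<epsilon>)) \<longleftrightarrow>
        (1 - \<epsilon>) * prob (cap_set z0 (cos \<theta>) \<inter> cap_set y0 (cos \<omega>))
            < prob (A \<inter> cap_set y (cos (min pi (\<omega> + \<epsilon>))))"
        using K(1) by (simp only: mult_less_cancel_left_pos)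
    qed
    then show "1 - \<epsilon> \<le> prob {y \<in> S. (1 - \<epsilon>) * V < measure \<mu> (A \<inter> sph_cap m R y (\<omega> + \<epsilon>))}"
      using prob_large_intersection[OF A[unfolded sets_eq] z0 y0(1) z0y0 \<theta>(1,2) pA \<omega> assms True M]
        by simp
  qed
qed

end
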